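(* Let $X$ be a smooth, compact $d$-dimensional Riemannian manifold without boundary, $d\ge3$, and let $N_0>0$ be an integer. Then there exist values of the positive integer $K$ such that the rival shops have a winning strategy for all $N\le N_0$; that is, for every sequence $(x_i)_{i\ge1}$ in $X$ they can choose a sequence $(y_j)_{j\ge1}$ in $X$ such that, with $$\mu_N=\sum_{i=1}^N\delta_{x_i}-\sum_{j=1}^{N+K}\delta_{y_j},$$ for all integers $1\le N\le N_0$, $$\mathbf{W}_1^{1,1}\left(\frac{1}{2N+K}\mu_N,dx\right)>\mathbf{W}_1^{1,1}\left(\frac{1}{2N+K}(-\mu_N),dx\right).$$
   Context: $\operatorname{dist}$ is the Riemannian distance on $X$ and $dx$ is the Riemannian volume measure normalized so that $dx(X)=1$. $\delta_p$ is the Dirac measure at $p$. The points $x_i$ are our shops and the points $y_j$ are the rival's shops; the rival starts with an advantage of $K$ shops, is allowed to choose the $y_j$ depending on the $x_i$, and points may coincide. $\mathcal M(X)$ is the set of positive finite measures on $X$, and $\mathcal M^s(X)$ the set of signed finite measures on $X$. For $\mu\in\mathcal M^s(X)$ with Jordan decomposition $\mu=\mu_+-\mu_-$, the total mass is $|\mu|:=\mu_+(X)+\mu_-(X)$. For $\mu,\nu\in\mathcal M(X)$ with $|\mu|=|\nu|$, $W_1(\mu,\nu)=\min_\pi\int_{X\times X}\operatorname{dist}(x,y)\,d\pi(x,y)$, the minimum being over positive finite measures $\pi$ on $X\times X$ with marginals $\mu$ and $\nu$. For $\mu,\nu\in\mathcal M(X)$ (possibly of different mass), $$W_1^{1,1}(\mu,\nu)=\inf_{\tilde\mu,\tilde\nu\in\mathcal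 M(X),\ |\tilde\mu|=|\tilde\nu|}\ |\mu-\tilde\mu|+|\nu-\tilde\nu|+W_1(\tilde\mu,\tilde\nu).$$ For $\mu,\nu\in\mathcal M^s(X)$, the signed Wasserstein distance is $\mathbf{W}_1^{1,1}(\mu,\nu):=W_1^{1,1}(\mu_++\nu_-,\ \mu_-+\nu_+)$. *)

theory Defs
  imports "HOL-Probability.Probability"
begin

section \<open>Smooth Riemannian manifolds\<close>

text \<open>Continuous differentiability of order \<open>k\<close> and smoothness on an open set \<open>S\<close>.\<close>

fun Ck_on :: "nat \<Rightarrow> ('a::real_normed_vector \<Rightarrow> 'b::real_normed_vector) \<Rightarrow> 'a set \<Rightarrow> bool" where
  "Ck_on 0 f S \<longleftrightarrow> continuous_on S f"
| "Ck_on (Suc k) f S \<longleftrightarrow> (\<forall>x\<in>S. f differentiable (at x)) \<and>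
      (\<forall>v. Ck_on k (\<lambda>x. frechet_derivative f (at x) v) S)"

definition smooth_on :: "('a::real_normed_vector \<Rightarrow> 'b::real_normed_vector) \<Rightarrow> 'a set \<Rightarrow> bool" where
  "smooth_on f S \<longleftrightarrow> (\<forall>k. Ck_on k f S)"

text \<open>A chart \<open>(U, \<phi>)\<close> consists of its domain and its coordinate map; the values of \<open>\<phi>\<close>
  outside \<open>U\<close> are irrelevant.\<close>

type_synonym ('a, 'd) chart = "'a set \<times> ('a \<Rightarrow> real ^ 'd)"

definition transition :: "('a, 'd) chart \<Rightarrow> ('a, 'd) chart \<Rightarrow> real ^ 'd \<Rightarrow> real ^ 'd" where
  "transition c c' = snd c' \<circ> inv_into (fst c) (snd c)"

text \<open>A smooth manifold without boundary: all charts are onto open subsets of the full Euclidean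
  space.  The atlas need not be maximal.\<close>

locale smooth_manifold =
  fixes X :: "'a topology" and atlas :: "('a, 'd::finite) chart set"
  assumes Hausdorff: "Hausdorff_space X"
    and second_countable: "second_countable X"
    and chart_domain: "\<And>U \<phi>. (U, \<phi>) \<in> atlas \<Longrightarrow> openin X U"
    and chart_image: "\<And>U \<phi>. (U, \<phi>) \<in> atlas \<Longrightarrow> open (\<phi> ` U)"
    and chart_homeomorphic: "\<And>U \<phi>. (U, \<phi>) \<in> atlas \<Longrightarrow>
          homeomorphic_map (subtopology X U) (top_of_set (\<phi> ` U)) \<phi>"
    and atlas_covers: "(\<Union>(U, \<phi>)\<in>atlas. U) = topspace X"
    and transition_smooth: "\<And>U \<phi> V \<psi>. (U, \<phi>) \<in> atlas \<Longrightarrow> (V, \<psi>) \<in> atlas \<Longrightarrow>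
          smooth_on (transition (U, \<phi>) (V, \<psi>)) (\<phi> ` (U \<inter> V))"

text \<open>The metric tensor is given by its coordinate matrices: \<open>g c y\<close> is the Gram matrix in the
  chart \<open>c\<close> at the point with coordinates \<open>y\<close>.\<close>

locale riemannian_manifold = smooth_manifold X atlas
  for X :: "'a topology" and atlas :: "('a, 'd::finite) chart set" +
  fixes g :: "('a, 'd) chart \<Rightarrow> real ^ 'd \<Rightarrow> real ^ 'd ^ 'd"
  assumes metric_smooth: "\<And>U \<phi>. (U, \<phi>) \<in> atlas \<Longrightarrow> smooth_on (g (U, \<phi>)) (\<phi> ` U)"
    and metric_symmetric: "\<And>U \<phi> y. (U, \<phi>) \<in> atlas \<Longrightarrow> y \<in> \<phi> ` U \<Longrightarrow>
          transpose (g (U, \<phi>) y) = g (U, \<phi>) y"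
    and metric_positive: "\<And>U \<phi> y v. (U, \<phi>) \<in> atlas \<Longrightarrow> y \<in> \<phi> ` U \<Longrightarrow> v \<noteq> 0 \<Longrightarrow>
          v \<bullet> (g (U, \<phi>) y *v v) > 0"
    and metric_transforms: "\<And>U \<phi> V \<psi> y v w. (U, \<phi>) \<in> atlas \<Longrightarrow> (V, \<psi>) \<in> atlas \<Longrightarrow>
          y \<in> \<phi> ` (U \<inter> V) \<Longrightarrow>
          (let \<tau> = transition (U, \<phi>) (V, \<psi>); D = frechet_derivative \<tau> (at y)
           in v \<bullet> (g (U, \<phi>) y *v w) = D v \<bullet> (g (V, \<psi>) (\<tau> y) *v D w))"


section \<open>Riemannian distance and volume\<close>

text \<open>Following the library's \<^const>\<open>piecewise_C1_differentiable_on\<close>, one-sided limits of the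
  derivative at the finitely many break points are not required; by continuity of the distance,
  admitting these curves does not change the infimum of lengths.\<close>

definition piecewise_C1_curve ::
    "'a topology \<Rightarrow> ('a, 'd::finite) chart set \<Rightarrow> (real \<Rightarrow> 'a) \<Rightarrow> bool" where
  "piecewise_C1_curve X atlas \<gamma> \<longleftrightarrow> pathin X \<gamma> \<and>
     (\<forall>(U, \<phi>)\<in>atlas. \<forall>a b. 0 \<le> a \<and> a < b \<and> b \<le> 1 \<and> \<gamma> ` {a..b} \<subseteq> U \<longrightarrow>
        (\<phi> \<circ> \<gamma>) piecewise_C1_differentiable_on {a..b})"

text \<open>The Riemannian norm of the velocity does not depend on the chart around \<open>\<gamma> t\<close>.\<close>

definition speed :: "('a, 'd::finite) chart set \<Rightarrow> (('a, 'd) chart \<Rightarrow> real ^ 'd \<Rightarrow> real ^ 'd ^ 'd) \<Rightarrow>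
    (real \<Rightarrow> 'a) \<Rightarrow> real \<Rightarrow> real" where
  "speed atlas g \<gamma> t =
     (let c = (SOME c. c \<in> atlas \<and> \<gamma> t \<in> fst c); v = vector_derivative (snd c \<circ> \<gamma>) (at t)
      in sqrt (v \<bullet> (g c (snd c (\<gamma> t)) *v v)))"

definition curve_length :: "('a, 'd::finite) chart set \<Rightarrow>
    (('a, 'd) chart \<Rightarrow> real ^ 'd \<Rightarrow> real ^ 'd ^ 'd) \<Rightarrow> (real \<Rightarrow> 'a) \<Rightarrow> ennreal" where
  "curve_length atlas g \<gamma> = (\<integral>\<^sup>+ t\<in>{0..1}. ennreal (speed atlas g \<gamma> t) \<partial>lborel)"

text \<open>The distance is extended-valued: it is infinite between different connected components.\<close>

definition riemannian_dist :: "'a topology \<Rightarrow> ('a, 'd::finite) chart set \<Rightarrow>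
    (('a, 'd) chart \<Rightarrow> real ^ 'd \<Rightarrow> real ^ 'd ^ 'd) \<Rightarrow> 'a \<Rightarrow> 'a \<Rightarrow> ennreal" where
  "riemannian_dist X atlas g p q =
     (INF \<gamma>\<in>{\<gamma>. piecewise_C1_curve X atlas \<gamma> \<and> \<gamma> 0 = p \<and> \<gamma> 1 = q}. curve_length atlas g \<gamma>)"

definition borel_of :: "'a topology \<Rightarrow> 'a measure" where
  "borel_of X = sigma (topspace X) {U. openin X U}"

text \<open>The volume measure is the unique Borel measure with density \<open>sqrt (det g)\<close> in every chart.\<close>

definition riemannian_volume :: "'a topology \<Rightarrow> ('a, 'd::finite) chart set \<Rightarrow>
    (('a, 'd) chart \<Rightarrow> real ^ 'd \<Rightarrow> real ^ 'd ^ 'd) \<Rightarrow> 'a measure" where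
  "riemannian_volume X atlas g =
     (THE \<nu>. sets \<nu> = sets (borel_of X) \<and>
        (\<forall>(U, \<phi>)\<in>atlas. \<forall>A\<in>sets (borel_of X). A \<subseteq> U \<longrightarrow>
           emeasure \<nu> A = (\<integral>\<^sup>+ y\<in>\<phi> ` A. ennreal (sqrt (det (g (U, \<phi>) y))) \<partial>lborel)))"

definition normalized_volume :: "'a topology \<Rightarrow> ('a, 'd::finite) chart set \<Rightarrow>
    (('a, 'd) chart \<Rightarrow> real ^ 'd \<Rightarrow> real ^ 'd ^ 'd) \<Rightarrow> 'a measure" where
  "normalized_volume X atlas g =
     (let vol = riemannian_volume X atlas g
      in scale_measure (inverse (emeasure vol (topspace X))) vol)"


section \<open>Signed measures and Wasserstein distances\<close>

text \<open>In this section the measure \<open>M\<close> only provides the measurable space.  Positive finite measures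
  are measures in the sense of the library; a signed finite measure is a real set function, of which
  only the values on \<^term>\<open>sets M\<close> matter.\<close>

definition finite_measures :: "'a measure \<Rightarrow> 'a measure set" where
  "finite_measures M = {\<mu>. sets \<mu> = sets M \<and> finite_measure \<mu>}"

definition jordan_decomposition ::
    "'a measure \<Rightarrow> ('a set \<Rightarrow> real) \<Rightarrow> 'a measure \<Rightarrow> 'a measure \<Rightarrow> bool" where
  "jordan_decomposition M \<sigma> \<mu> \<nu> \<longleftrightarrow>
     \<mu> \<in> finite_measures M \<and> \<nu> \<in> finite_measures M \<and>
     (\<forall>A\<in>sets M. \<sigma> A = measure \<mu> A - measure \<nu> A) \<and>
     (\<exists>P\<in>sets M. emeasure \<mu> (space M - P) = 0 \<and> emeasure \<nu> P = 0)"

definition pos_part :: "'a measure \<Rightarrow> ('a set \<Rightarrow> real) \<Rightarrow> 'a measure" where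
  "pos_part M \<sigma> = (THE \<mu>. \<exists>\<nu>. jordan_decomposition M \<sigma> \<mu> \<nu>)"

definition neg_part :: "'a measure \<Rightarrow> ('a set \<Rightarrow> real) \<Rightarrow> 'a measure" where
  "neg_part M \<sigma> = (THE \<nu>. \<exists>\<mu>. jordan_decomposition M \<sigma> \<mu> \<nu>)"

definition total_mass :: "'a measure \<Rightarrow> ('a set \<Rightarrow> real) \<Rightarrow> real" where
  "total_mass M \<sigma> = measure (pos_part M \<sigma>) (space M) + measure (neg_part M \<sigma>) (space M)"

definition add_measure :: "'a measure \<Rightarrow> 'a measure \<Rightarrow> 'a measure" where
  "add_measure \<mu> \<nu> = measure_of (space \<mu>) (sets \<mu>) (\<lambda>A. emeasure \<mu> A + emeasure \<nu> A)"

definition couplings :: "'a measure \<Rightarrow> 'a measure \<Rightarrow> 'a measure \<Rightarrow> ('a \<times> 'a) measure set" where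
  "couplings M \<mu> \<nu> = {\<pi>\<in>finite_measures (M \<Otimes>\<^sub>M M). distr \<pi> M fst = \<mu> \<and> distr \<pi> M snd = \<nu>}"

definition W1 :: "'a measure \<Rightarrow> ('a \<Rightarrow> 'a \<Rightarrow> ennreal) \<Rightarrow> 'a measure \<Rightarrow> 'a measure \<Rightarrow> ennreal" where
  "W1 M d \<mu> \<nu> = (INF \<pi>\<in>couplings M \<mu> \<nu>. \<integral>\<^sup>+ (x, y). d x y \<partial>\<pi>)"

text \<open>The generalized distance \<open>W\<^sub>1\<^sup>1\<^sup>,\<^sup>1\<close> between positive measures of possibly different mass.\<close>

definition W1_gen :: "'a measure \<Rightarrow> ('a \<Rightarrow> 'a \<Rightarrow> ennreal) \<Rightarrow> 'a measure \<Rightarrow> 'a measure \<Rightarrow> ennreal" where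
  "W1_gen M d \<mu> \<nu> =
     (INF (\<mu>', \<nu>')\<in>{(\<mu>', \<nu>'). \<mu>' \<in> finite_measures M \<and> \<nu>' \<in> finite_measures M \<and>
                         total_mass M (measure \<mu>') = total_mass M (measure \<nu>')}.
        ennreal (total_mass M (\<lambda>A. measure \<mu> A - measure \<mu>' A)) +
        ennreal (total_mass M (\<lambda>A. measure \<nu> A - measure \<nu>' A)) +
        W1 M d \<mu>' \<nu>')"

definition W1_signed :: "'a measure \<Rightarrow> ('a \<Rightarrow> 'a \<Rightarrow> ennreal) \<Rightarrow>
    ('a set \<Rightarrow> real) \<Rightarrow> ('a set \<Rightarrow> real) \<Rightarrow> ennreal" where
  "W1_signed M d \<sigma> \<tau> =
     W1_gen M d (add_measure (pos_part M \<sigma>) (neg_part M \<tau>))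
                (add_measure (neg_part M \<sigma>) (pos_part M \<tau>))"

definition shop_measure ::
    "'a measure \<Rightarrow> (nat \<Rightarrow> 'a) \<Rightarrow> (nat \<Rightarrow> 'a) \<Rightarrow> nat \<Rightarrow> nat \<Rightarrow> 'a set \<Rightarrow> real" where
  "shop_measure M x y K N A =
     (\<Sum>i=1..N. measure (return M (x i)) A) - (\<Sum>j=1..N+K. measure (return M (y j)) A)"

end

theory Submission
  imports Defs
begin

text \<open>The rival puts all shops on one point \<open>p\<close>, independently of our shops, and takes \<open>K\<close> large.
  Comparing total masses, the left-hand distance is at least \<open>1 + K / (2 N + K)\<close>, which tends
  to \<open>2\<close> as \<open>K\<close> grows.  In the right-hand distance all masses together are at most \<open>2\<close>, and some
  mass \<open>m > 0\<close>, not depending on \<open>K\<close>, can be transported from \<open>p\<close> into a small ball around \<open>p\<close>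
  at cost at most \<open>m\<close> instead of being discarded at both ends at cost \<open>2 m\<close>; this distance is
  therefore at most \<open>2 - m\<close>.  Only the existence, finiteness and positivity on balls of the
  Riemannian volume and a local upper bound for the distance are needed.\<close>

section \<open>Jordan decompositions and Wasserstein distances\<close>

text \<open>Write c = 1/(2N+K). The lower bound 1 + cK equals 2 - 2Nc and the upper bound is 2 - m,
  so the rival wins once 2N/(2N+K) < m; any K > 2 \<open>N0\<close> / m settles all N up to
  \<open>N0\<close> together. To avoid circularity, m is fixed before K: it is capped by the volume
  of the ball, and by 1/2 because p retains mass at least cK >= 1/2 even when all our shops sit on p
  and cancel rival shops. Infinite distances between components do no harm, since mass is moved only
  inside one chart.

  Most of the length comes from definite descriptions: \<open>pos_part\<close>,
  \<open>neg_part\<close> and \<open>riemannian_volume\<close> are \<open>THE\<close> terms, about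
  which nothing can be said before existence and uniqueness are proved. For the volume this requires
  that the densities of overlapping charts agree, which is the change of variables formula for
  transition maps, and that the chart measures be glued along a finite Borel partition whose pieces
  each lie in one chart.\<close>

lemma sets_add_measure [simp]: "sets (add_measure \<mu> \<nu>) = sets \<mu>"
  and space_add_measure [simp]: "space (add_measure \<mu> \<nu>) = space \<mu>"
  by (auto simp: add_measure_def)

lemma emeasure_add_measure:
  assumes "sets \<mu> = sets \<nu>" "A \<in> sets \<mu>"
  shows "emeasure (add_measure \<mu> \<nu>) A = emeasure \<mu> A + emeasure \<nu> A"
  unfolding add_measure_def
proof (rule emeasure_measure_of_sigma)
  show "sigma_algebra (space \<mu>) (sets \<mu>)" ..
  show "positive (sets \<mu>) (\<lambda>A. emeasure \<mu> A + emeasure \<nu> A)"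
    by (simp add: positive_def)
  show "countably_additive (sets \<mu>) (\<lambda>A. emeasure \<mu> A + emeasure \<nu> A)"
  proof (rule countably_additiveI)
    fix F :: "nat \<Rightarrow> 'a set"
    assume F: "range F \<subseteq> sets \<mu>" "disjoint_family F"
    have "(\<Sum>i. emeasure \<mu> (F i) + emeasure \<nu> (F i)) = (\<Sum>i. emeasure \<mu> (F i)) + (\<Sum>i. emeasure \<nu> (F i))"
      by (rule suminf_add[symmetric]) auto
    then show "(\<Sum>i. emeasure \<mu> (F i) + emeasure \<nu> (F i)) = emeasure \<mu> (\<Union>i. F i) + emeasure \<nu> (\<Union>i. F i)"
      using F assms(1) by (simp add: suminf_emeasure)
  qed
qed fact

text \<open>Serves to glue chart measures, which may not be known to be finite at that stage; hence
  the formulation with \<open>emeasure\<close>.\<close>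

lemma sum_measure_exists:
  assumes "finite I" "\<And>i. i \<in> I \<Longrightarrow> sets (\<nu> i) = sets M"
  shows "\<exists>\<mu>. sets \<mu> = sets M \<and> (\<forall>A\<in>sets M. emeasure \<mu> A = (\<Sum>i\<in>I. emeasure (\<nu> i) A))"
  using assms
proof (induction I)
  case empty
  show ?case by (intro exI[of _ "null_measure M"]) simp
next
  case (insert i I)
  then obtain \<mu> where "sets \<mu> = sets M" "\<forall>A\<in>sets M. emeasure \<mu> A = (\<Sum>i\<in>I. emeasure (\<nu> i) A)"
    by auto
  moreover have "sets (\<nu> i) = sets M" using insert.prems by simp
  ultimately show ?case
    using insert.hyps by (intro exI[of _ "add_measure (\<nu> i) \<mu>"]) (simp add: emeasure_add_measure)
qed

lemma finite_measures_space: "\<mu> \<in> finite_measures M \<Longrightarrow> space \<mu> = space M"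
  by (auto simp: finite_measures_def dest: sets_eq_imp_space_eq)

lemma finite_measures_emeasure:
  assumes "\<mu> \<in> finite_measures M"
  shows "emeasure \<mu> A = ennreal (measure \<mu> A)"
  using assms by (auto simp: finite_measures_def finite_measure.emeasure_eq_measure)

lemma finite_measures_eqI:
  assumes "\<mu> \<in> finite_measures M" "\<nu> \<in> finite_measures M"
    and "\<And>A. A \<in> sets M \<Longrightarrow> measure \<mu> A = measure \<nu> A"
  shows "\<mu> = \<nu>"
  using assms by (intro measure_eqI) (auto simp: finite_measures_emeasure finite_measures_def finite_measure.emeasure_eq_measure)

lemma finite_measures_Un:
  assumes "\<mu> \<in> finite_measures M" "A \<in> sets M" "P \<in> sets M"
  shows "measure \<mu> A = measure \<mu> (A \<inter> P) + measure \<mu> (A - P)"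
proof -
  interpret finite_measure \<mu> using assms by (simp add: finite_measures_def)
  have "A = (A \<inter> P) \<union> (A - P)" by auto
  then show ?thesis
    using assms finite_measure_Union[of "A \<inter> P" "A - P"] by (auto simp: finite_measures_def)
qed

lemma finite_measures_mono:
  assumes "\<mu> \<in> finite_measures M" "A \<subseteq> B" "B \<in> sets M"
  shows "measure \<mu> A \<le> measure \<mu> B"
  using assms by (auto simp: finite_measures_def intro: finite_measure.finite_measure_mono)

lemma null_measure_finite_measures: "null_measure M \<in> finite_measures M"
  by (auto simp: finite_measures_def intro!: finite_measureI)

lemma return_finite_measures: "p \<in> space M \<Longrightarrow> return M p \<in> finite_measures M"
  by (auto simp: finite_measures_def intro: prob_space.finite_measure prob_space_return)

lemma add_measure_finite_measures:
  assumes "\<mu> \<in> finite_measures M" "\<nu> \<in> finite_measures M"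
  shows "add_measure \<mu> \<nu> \<in> finite_measures M"
    and "A \<in> sets M \<Longrightarrow> measure (add_measure \<mu> \<nu>) A = measure \<mu> A + measure \<nu> A"
proof -
  have em: "emeasure (add_measure \<mu> \<nu>) A = ennreal (measure \<mu> A + measure \<nu> A)" if "A \<in> sets M" for A
    using assms that
    by (subst emeasure_add_measure) (auto simp: finite_measures_emeasure[OF assms(1)] finite_measures_emeasure[OF assms(2)] finite_measures_def)
  then show "A \<in> sets M \<Longrightarrow> measure (add_measure \<mu> \<nu>) A = measure \<mu> A + measure \<nu> A"
    by (auto intro!: measure_eq_emeasure_eq_ennreal)
  show "add_measure \<mu> \<nu> \<in> finite_measures M"
    using em[of "space M"] assms finite_measures_space[OF assms(1)]
    by (auto simp: finite_measures_def intro!: finite_measureI)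
qed

lemma scale_finite_measures:
  assumes "\<mu> \<in> finite_measures M" "0 \<le> c"
  shows "scale_measure (ennreal c) \<mu> \<in> finite_measures M"
    and "measure (scale_measure (ennreal c) \<mu>) A = c * measure \<mu> A"
proof -
  have em: "emeasure (scale_measure (ennreal c) \<mu>) A = ennreal (c * measure \<mu> A)" for A
    using assms by (simp add: finite_measures_emeasure[OF assms(1)] ennreal_mult)
  then show "measure (scale_measure (ennreal c) \<mu>) A = c * measure \<mu> A"
    using assms(2) by (simp add: measure_def)
  show "scale_measure (ennreal c) \<mu> \<in> finite_measures M"
    using em[of "space \<mu>"] assms
    by (auto simp: finite_measures_def space_scale_measure intro!: finite_measureI)
qed

text \<open>Restriction to \<open>B\<close> is expressed by a density so that the result still lives
  on the sigma-algebra of \<open>M\<close>.\<close>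

lemma density_indicator_finite_measures:
  assumes "\<mu> \<in> finite_measures M" "B \<in> sets M"
  shows "density \<mu> (indicator B) \<in> finite_measures M"
    and "A \<in> sets M \<Longrightarrow> measure (density \<mu> (indicator B)) A = measure \<mu> (A \<inter> B)"
proof -
  have em: "emeasure (density \<mu> (indicator B)) A = ennreal (measure \<mu> (A \<inter> B))" if "A \<in> sets M" for A
    using assms that
    by (subst emeasure_density) (auto simp: finite_measures_def indicator_inter_arith[symmetric] Int_commute finite_measures_emeasure[OF assms(1)])
  then show "A \<in> sets M \<Longrightarrow> measure (density \<mu> (indicator B)) A = measure \<mu> (A \<inter> B)"
    by (simp add: measure_def)
  show "density \<mu> (indicator B) \<in> finite_measures M"
    using em[of "space M"] assms finite_measures_space[OF assms(1)]
    by (auto simp: finite_measures_def intro!: finite_measureI)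
qed

lemma sum_finite_measures:
  assumes "finite I" "\<And>i. i \<in> I \<Longrightarrow> \<nu> i \<in> finite_measures M"
  shows "\<exists>\<mu>\<in>finite_measures M. \<forall>A\<in>sets M. measure \<mu> A = (\<Sum>i\<in>I. measure (\<nu> i) A)"
  using assms
proof (induction I)
  case empty
  then show ?case using null_measure_finite_measures[of M] by (auto simp: measure_def[of "null_measure M"] intro!: bexI[of _ "null_measure M"])
next
  case (insert i I)
  then obtain \<mu> where "\<mu> \<in> finite_measures M" "\<forall>A\<in>sets M. measure \<mu> A = (\<Sum>i\<in>I. measure (\<nu> i) A)"
    by auto
  moreover have "\<nu> i \<in> finite_measures M" using insert by auto
  ultimately show ?case
    using insert(1,2) by (intro bexI[of _ "add_measure (\<nu> i) \<mu>"]) (auto simp: add_measure_finite_measures(1) add_measure_finite_measures(2)[of "\<nu> i" M \<mu>])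
qed

section \<open>Jordan decomposition: uniqueness, existence, total mass\<close>

text \<open>On a Hahn set \<open>P\<close> the negative part vanishes, off \<open>P\<close> the
  positive part does, so \<open>\<sigma>\<close> and \<open>P\<close> alone determine both. All
  later estimates of Jordan parts go through this form.\<close>

lemma jordan_decomposition_restrict:
  assumes "jordan_decomposition M \<sigma> \<mu> \<nu>"
  shows "\<exists>P\<in>sets M. \<forall>A\<in>sets M. measure \<mu> A = \<sigma> (A \<inter> P) \<and> measure \<nu> A = - \<sigma> (A - P)"
proof -
  from assms obtain P where P: "P \<in> sets M" "emeasure \<mu> (space M - P) = 0" "emeasure \<nu> P = 0"
    and \<mu>: "\<mu> \<in> finite_measures M" and \<nu>: "\<nu> \<in> finite_measures M"
    and \<sigma>: "\<And>A. A \<in> sets M \<Longrightarrow> \<sigma> A = measure \<mu> A - measure \<nu> A"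
    by (auto simp: jordan_decomposition_def)
  have 1: "measure \<mu> (A - P) = 0" if "A \<in> sets M" for A
  proof -
    have "measure \<mu> (A - P) \<le> measure \<mu> (space M - P)"
      using that P sets.sets_into_space[OF that] by (intro finite_measures_mono[OF \<mu>]) auto
    then show ?thesis using P by (simp add: measure_def[of \<mu> "space M - P"] measure_le_0_iff)
  qed
  have 2: "measure \<nu> (A \<inter> P) = 0" if "A \<in> sets M" for A
  proof -
    have "measure \<nu> (A \<inter> P) \<le> measure \<nu> P"
      using that P by (intro finite_measures_mono[OF \<nu>]) auto
    then show ?thesis using P by (simp add: measure_def[of \<nu> P] measure_le_0_iff)
  qed
  show ?thesis
  proof (intro bexI[OF _ P(1)] ballI conjI)
    fix A assume A: "A \<in> sets M"
    show "measure \<mu> A = \<sigma> (A \<inter> P)"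
      using A P finite_measures_Un[OF \<mu> A P(1)] 1[OF A] 2[OF A] by (simp add: \<sigma>)
    show "measure \<nu> A = - \<sigma> (A - P)"
      using A P finite_measures_Un[OF \<nu> A P(1)] 1[OF A] 2[OF A] by (simp add: \<sigma>)
  qed
qed

text \<open>Minimality: the Hahn set \<open>P\<close> of the first decomposition is tested against
  the second, and \<open>\<sigma> (A \<inter> P) \<le> measure \<mu>' (A \<inter> P)\<close> follows
  by dropping \<open>\<nu>'\<close>. Used in both directions it yields uniqueness without comparing
  two Hahn sets.\<close>

lemma jordan_decomposition_le:
  assumes "jordan_decomposition M \<sigma> \<mu> \<nu>" "jordan_decomposition M \<sigma> \<mu>' \<nu>'" "A \<in> sets M"
  shows "measure \<mu> A \<le> measure \<mu>' A" "measure \<nu> A \<le> measure \<nu>' A"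
proof -
  obtain P where P: "P \<in> sets M"
    "\<And>A. A \<in> sets M \<Longrightarrow> measure \<mu> A = \<sigma> (A \<inter> P)"
    "\<And>A. A \<in> sets M \<Longrightarrow> measure \<nu> A = - \<sigma> (A - P)"
    using jordan_decomposition_restrict[OF assms(1)] by auto
  have *: "\<mu>' \<in> finite_measures M" "\<nu>' \<in> finite_measures M"
    "\<And>A. A \<in> sets M \<Longrightarrow> \<sigma> A = measure \<mu>' A - measure \<nu>' A"
    using assms(2) by (auto simp: jordan_decomposition_def)
  have "\<sigma> (A \<inter> P) \<le> measure \<mu>' (A \<inter> P)" "- \<sigma> (A - P) \<le> measure \<nu>' (A - P)"
    using P(1) assms(3) by (auto simp: *(3))
  moreover have "measure \<mu>' (A \<inter> P) \<le> measure \<mu>' A" "measure \<nu>' (A - P) \<le> measure \<nu>' A"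
    using assms(3) by (auto intro!: finite_measures_mono[OF *(1)] finite_measures_mono[OF *(2)])
  ultimately show "measure \<mu> A \<le> measure \<mu>' A" "measure \<nu> A \<le> measure \<nu>' A"
    using P(2,3)[OF assms(3)] by auto
qed

lemma jordan_decomposition_unique:
  assumes "jordan_decomposition M \<sigma> \<mu> \<nu>" "jordan_decomposition M \<sigma> \<mu>' \<nu>'"
  shows "\<mu> = \<mu>'" "\<nu> = \<nu>'"
proof -
  have fin: "\<mu> \<in> finite_measures M" "\<mu>' \<in> finite_measures M" "\<nu> \<in> finite_measures M" "\<nu>' \<in> finite_measures M"
    using assms by (auto simp: jordan_decomposition_def)
  show "\<mu> = \<mu>'"
    by (rule finite_measures_eqI[OF fin(1,2)]) (intro antisym jordan_decomposition_le(1)[OF assms] jordan_decomposition_le(1)[OF assms(2,1)])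
  show "\<nu> = \<nu>'"
    by (rule finite_measures_eqI[OF fin(3,4)]) (intro antisym jordan_decomposition_le(2)[OF assms] jordan_decomposition_le(2)[OF assms(2,1)])
qed

text \<open>Discharges the definite descriptions: from here on, exhibiting one decomposition
  computes both parts.\<close>

lemma jordan_decomposition_parts:
  assumes "jordan_decomposition M \<sigma> \<mu> \<nu>"
  shows "pos_part M \<sigma> = \<mu>" "neg_part M \<sigma> = \<nu>"
  unfolding pos_part_def neg_part_def
  using assms by (auto intro!: the_equality dest: jordan_decomposition_unique)

text \<open>The complement of the Hahn set serves for the negated measure. The two distances to be
  compared can thus share one decomposition with its parts exchanged.\<close>

lemma jordan_decomposition_uminus:
  assumes "jordan_decomposition M \<sigma> \<mu> \<nu>"
  shows "jordan_decomposition M (\<lambda>A. - \<sigma> A) \<nu> \<mu>"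
proof -
  obtain P where "P \<in> sets M" "emeasure \<mu> (space M - P) = 0" "emeasure \<nu> P = 0"
    using assms by (auto simp: jordan_decomposition_def)
  then have "space M - P \<in> sets M \<and> emeasure \<nu> (space M - (space M - P)) = 0 \<and> emeasure \<mu> (space M - P) = 0"
    using sets.sets_into_space[of P M] by (auto simp: double_diff)
  then show ?thesis
    using assms unfolding jordan_decomposition_def by auto
qed

text \<open>A Hahn set \<open>Y\<close> for the pair \<open>\<alpha>\<close>, \<open>\<beta>\<close>
  splits the space: \<open>\<alpha> - \<beta>\<close> is a positive measure on \<open>Y\<close> and
  \<open>\<beta> - \<alpha>\<close> on its complement. Countable additivity of the set function
  \<open>\<sigma>\<close> enters through its representation as such a difference.\<close>

lemma jordan_decomposition_exists:
  assumes \<alpha>: "\<alpha> \<in> finite_measures M" and \<beta>: "\<beta> \<in> finite_measures M"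
    and \<sigma>: "\<And>A. A \<in> sets M \<Longrightarrow> \<sigma> A = measure \<alpha> A - measure \<beta> A"
  obtains \<mu> \<nu> where "jordan_decomposition M \<sigma> \<mu> \<nu>"
proof -
  obtain Y where Y: "Y \<in> sets M"
    "\<And>A. A \<in> sets M \<Longrightarrow> A \<subseteq> Y \<Longrightarrow> emeasure \<beta> A \<le> emeasure \<alpha> A"
    "\<And>A. A \<in> sets M \<Longrightarrow> A \<inter> Y = {} \<Longrightarrow> emeasure \<alpha> A \<le> emeasure \<beta> A"
    using finite_unsigned_Hahn_decomposition[of \<alpha> \<beta>] \<alpha> \<beta> by (auto simp: finite_measures_def)
  \<comment> \<open>Stated for arbitrary \<open>\<alpha>'\<close>, \<open>\<beta>'\<close>,
    \<open>Z\<close> because it is applied twice, with the roles of \<open>\<alpha>\<close> and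
    \<open>\<beta>\<close> exchanged on the complement of \<open>Y\<close>.\<close>
  have diff: "\<exists>\<mu>\<in>finite_measures M. \<forall>A\<in>sets M. measure \<mu> A = measure \<alpha>' (A \<inter> Z) - measure \<beta>' (A \<inter> Z)"
    if "\<alpha>' \<in> finite_measures M" "\<beta>' \<in> finite_measures M" "Z \<in> sets M"
      "\<And>A. A \<in> sets M \<Longrightarrow> A \<subseteq> Z \<Longrightarrow> emeasure \<beta>' A \<le> emeasure \<alpha>' A" for \<alpha>' \<beta>' Z
  proof -
    let ?a = "density \<alpha>' (indicator Z)" and ?b = "density \<beta>' (indicator Z)"
    note ab = density_indicator_finite_measures[OF that(1,3)] density_indicator_finite_measures[OF that(2,3)]
    have le: "measure ?b A \<le> measure ?a A" if "A \<in> sets M" for A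
      using that \<open>\<And>A. A \<in> sets M \<Longrightarrow> A \<subseteq> Z \<Longrightarrow> emeasure \<beta>' A \<le> emeasure \<alpha>' A\<close>[of "A \<inter> Z"] \<open>Z \<in> sets M\<close>
      by (simp add: ab finite_measures_emeasure[OF \<open>\<alpha>' \<in> _\<close>] finite_measures_emeasure[OF \<open>\<beta>' \<in> _\<close>])
    have em: "emeasure (diff_measure ?a ?b) A = ennreal (measure ?a A - measure ?b A)" if "A \<in> sets M" for A
      using ab(1,3) that le
      by (subst emeasure_diff_measure)
        (auto simp: finite_measures_emeasure[OF ab(1)] finite_measures_emeasure[OF ab(3)] ennreal_minus ennreal_leI finite_measures_def)
    show ?thesis
    proof (intro bexI[of _ "diff_measure ?a ?b"] ballI)
      show "diff_measure ?a ?b \<in> finite_measures M"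
        using em[of "space M"] ab(1) finite_measures_space[OF ab(1)]
        by (auto simp: finite_measures_def intro!: finite_measureI)
      show "measure (diff_measure ?a ?b) A = measure \<alpha>' (A \<inter> Z) - measure \<beta>' (A \<inter> Z)" if "A \<in> sets M" for A
        using em[OF that] le[OF that] that ab(2,4) by (simp add: measure_def)
    qed
  qed
  obtain \<mu> where \<mu>: "\<mu> \<in> finite_measures M" "\<And>A. A \<in> sets M \<Longrightarrow> measure \<mu> A = measure \<alpha> (A \<inter> Y) - measure \<beta> (A \<inter> Y)"
    using diff[OF \<alpha> \<beta> Y(1,2)] by auto
  obtain \<nu> where \<nu>: "\<nu> \<in> finite_measures M"
    "\<And>A. A \<in> sets M \<Longrightarrow> measure \<nu> A = measure \<beta> (A \<inter> (space M - Y)) - measure \<alpha> (A \<inter> (space M - Y))"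
  proof -
    have "emeasure \<alpha> A \<le> emeasure \<beta> A" if "A \<in> sets M" "A \<subseteq> space M - Y" for A
      using that by (intro Y(3)) auto
    then show ?thesis
      using diff[OF \<beta> \<alpha>, of "space M - Y"] Y(1) that by blast
  qed
  have "jordan_decomposition M \<sigma> \<mu> \<nu>"
    unfolding jordan_decomposition_def
  proof (intro conjI ballI bexI[of _ Y])
    fix A assume A: "A \<in> sets M"
    then have "A \<inter> (space M - Y) = A - Y" using sets.sets_into_space by blast
    then show "\<sigma> A = measure \<mu> A - measure \<nu> A"
      using A finite_measures_Un[OF \<alpha> A Y(1)] finite_measures_Un[OF \<beta> A Y(1)] by (simp add: \<sigma> \<mu> \<nu>)
  next
    have "(space M - Y) \<inter> Y = {}" "Y \<inter> (space M - Y) = {}" by auto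
    then show "emeasure \<mu> (space M - Y) = 0" "emeasure \<nu> Y = 0"
      using Y(1) by (simp_all add: finite_measures_emeasure[OF \<mu>(1)] finite_measures_emeasure[OF \<nu>(1)] \<mu> \<nu>)
  qed (use \<mu> \<nu> Y in auto)
  then show thesis by (rule that)
qed

lemma total_mass_ge:
  assumes "\<alpha> \<in> finite_measures M" "\<beta> \<in> finite_measures M"
  shows "\<bar>measure \<alpha> (space M) - measure \<beta> (space M)\<bar> \<le> total_mass M (\<lambda>A. measure \<alpha> A - measure \<beta> A)"
proof -
  let ?\<sigma> = "\<lambda>A. measure \<alpha> A - measure \<beta> A"
  obtain \<mu> \<nu> where J: "jordan_decomposition M ?\<sigma> \<mu> \<nu>"
    using jordan_decomposition_exists[OF assms, of ?\<sigma>] by auto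
  then have "?\<sigma> (space M) = measure \<mu> (space M) - measure \<nu> (space M)"
    by (simp add: jordan_decomposition_def)
  then show ?thesis
    using measure_nonneg[of \<mu> "space M"] measure_nonneg[of \<nu> "space M"]
    unfolding total_mass_def jordan_decomposition_parts[OF J] by linarith
qed

text \<open>The negative part has total mass \<open>- \<sigma> (space M - P)\<close>, which cannot
  be positive, so it is zero and only the positive part counts.\<close>

lemma total_mass_eq:
  assumes "\<alpha> \<in> finite_measures M" "\<beta> \<in> finite_measures M"
    and "\<And>A. A \<in> sets M \<Longrightarrow> \<sigma> A = measure \<alpha> A - measure \<beta> A"
    and nonneg: "\<And>A. A \<in> sets M \<Longrightarrow> 0 \<le> \<sigma> A"
  shows "total_mass M \<sigma> = \<sigma> (space M)"
proof -
  obtain \<mu> \<nu> where J: "jordan_decomposition M \<sigma> \<mu> \<nu>"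
    using jordan_decomposition_exists[OF assms(1-3)] by auto
  then have "\<sigma> (space M) = measure \<mu> (space M) - measure \<nu> (space M)"
    by (simp add: jordan_decomposition_def)
  moreover have "measure \<nu> (space M) = 0"
  proof -
    obtain P where "P \<in> sets M" "measure \<nu> (space M) = - \<sigma> (space M - P)"
      using jordan_decomposition_restrict[OF J] by auto
    then show ?thesis
      using nonneg[of "space M - P"] measure_nonneg[of \<nu> "space M"] by simp
  qed
  ultimately show ?thesis
    by (simp add: total_mass_def jordan_decomposition_parts[OF J])
qed

lemma total_mass_measure:
  assumes "\<mu> \<in> finite_measures M"
  shows "total_mass M (measure \<mu>) = measure \<mu> (space M)"
  using total_mass_eq[OF assms null_measure_finite_measures, of "measure \<mu>"]
  by (simp add: measure_def)

text \<open>The whole space is a Hahn set. Applied to the volume, this is the source of the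
  \<open>null_measure M\<close> summands in the comparison of the two distances.\<close>

lemma positive_measure_parts:
  assumes "\<mu> \<in> finite_measures M"
  shows "pos_part M (measure \<mu>) = \<mu>" "neg_part M (measure \<mu>) = null_measure M"
proof -
  have "jordan_decomposition M (measure \<mu>) \<mu> (null_measure M)"
    using assms null_measure_finite_measures[of M] finite_measures_space[OF assms]
    unfolding jordan_decomposition_def by (auto simp: measure_def[of "null_measure M"] intro!: bexI[of _ "space M"])
  then show "pos_part M (measure \<mu>) = \<mu>" "neg_part M (measure \<mu>) = null_measure M"
    by (rule jordan_decomposition_parts)+
qed

section \<open>Bounds for the generalized distance and the choice of K\<close>

text \<open>Transport preserves mass, so the imbalance of \<open>\<mu>\<close> and
  \<open>\<nu>\<close> has to be paid in the two mass terms whatever the cost \<open>d\<close> is;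
  the transport term is dropped.\<close>

lemma W1_gen_ge_mass_difference:
  assumes "\<mu> \<in> finite_measures M" "\<nu> \<in> finite_measures M"
  shows "ennreal (measure \<nu> (space M) - measure \<mu> (space M)) \<le> W1_gen M d \<mu> \<nu>"
  unfolding W1_gen_def
proof (rule INF_greatest, clarify)
  fix \<mu>' \<nu>' assume *: "\<mu>' \<in> finite_measures M" "\<nu>' \<in> finite_measures M"
    "total_mass M (measure \<mu>') = total_mass M (measure \<nu>')"
  let ?a = "total_mass M (\<lambda>A. measure \<mu> A - measure \<mu>' A)"
  let ?b = "total_mass M (\<lambda>A. measure \<nu> A - measure \<nu>' A)"
  have "measure \<mu>' (space M) = measure \<nu>' (space M)"
    using * by (simp add: total_mass_measure)
  then have "measure \<nu> (space M) - measure \<mu> (space M) \<le> ?a + ?b" "0 \<le> ?a" "0 \<le> ?b"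
    using total_mass_ge[OF assms(1) *(1)] total_mass_ge[OF assms(2) *(2)] by linarith+
  then have "ennreal (measure \<nu> (space M) - measure \<mu> (space M)) \<le> ennreal ?a + ennreal ?b"
    by (simp add: ennreal_leI flip: ennreal_plus)
  also have "\<dots> \<le> ennreal ?a + ennreal ?b + W1 M d \<mu>' \<nu>'" by simp
  finally show "ennreal (measure \<nu> (space M) - measure \<mu> (space M)) \<le> ennreal ?a + ennreal ?b + W1 M d \<mu>' \<nu>'" .
qed

text \<open>Moving mass \<open>m\<close> from the point \<open>p\<close> into \<open>B\<close> costs at most \<open>m\<close> but lowers the
  two mass terms by \<open>m\<close> each.\<close>

lemma W1_gen_le_transport_from_point:
  assumes \<mu>: "\<mu> \<in> finite_measures M" and \<nu>: "\<nu> \<in> finite_measures M" and \<rho>: "\<rho> \<in> finite_measures M"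
    and p: "{p} \<in> sets M" and B: "B \<in> sets M" and d: "\<And>y. y \<in> B \<Longrightarrow> d p y \<le> 1"
    and \<rho>\<nu>: "\<And>A. A \<in> sets M \<Longrightarrow> measure \<rho> A \<le> measure \<nu> A"
    and \<rho>B: "measure \<rho> (space M - B) = 0"
    and m: "measure \<rho> (space M) = m" "m \<le> measure \<mu> {p}"
  shows "W1_gen M d \<mu> \<nu> \<le> ennreal (measure \<mu> (space M) + measure \<nu> (space M) - m)"
proof -
  have m0: "0 \<le> m" using m(1) by auto
  have [simp]: "p \<in> space M" using sets.sets_into_space[OF p] by auto
  have sets_\<rho>[measurable_cong, simp]: "sets \<rho> = sets M" and fin_\<rho>: "finite_measure \<rho>"
    using \<rho> by (auto simp: finite_measures_def)
  have sp[simp]: "space \<rho> = space M" "space \<mu> = space M" "space \<nu> = space M" by (rule finite_measures_space, fact)+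
  \<comment> \<open>The part of \<open>\<mu>\<close> that is transported, m times the Dirac measure
    at \<open>p\<close>; its target is \<open>\<rho>\<close>.\<close>
  define \<mu>' where "\<mu>' = scale_measure (ennreal m) (return M p)"
  have \<mu>': "\<mu>' \<in> finite_measures M" "\<And>A. A \<in> sets M \<Longrightarrow> measure \<mu>' A = m * indicator A p"
    using scale_finite_measures[OF return_finite_measures[of p M] m0]
    by (auto simp: \<mu>'_def measure_return)
  have \<mu>'\<mu>: "measure \<mu>' A \<le> measure \<mu> A" if "A \<in> sets M" for A
    using m(2) finite_measures_mono[OF \<mu> _ that, of "{p}"] that
    by (auto simp: \<mu>' indicator_def)
  have mass: "total_mass M (measure \<mu>') = total_mass M (measure \<rho>)"
    by (simp add: total_mass_measure \<mu>' \<rho> m)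
  have tm: "total_mass M (\<lambda>A. measure \<mu> A - measure \<mu>' A) = measure \<mu> (space M) - m"
    using total_mass_eq[OF \<mu> \<mu>'(1), of "\<lambda>A. measure \<mu> A - measure \<mu>' A"] \<mu>'\<mu> by (simp add: \<mu>')
  have tm': "total_mass M (\<lambda>A. measure \<nu> A - measure \<rho> A) = measure \<nu> (space M) - m"
    using total_mass_eq[OF \<nu> \<rho>, of "\<lambda>A. measure \<nu> A - measure \<rho> A"] \<rho>\<nu> m by simp
  \<comment> \<open>The product coupling of the point mass with \<open>\<rho>\<close>, written as a
    push-forward so that its marginals are compositions.\<close>
  define \<pi> where "\<pi> = distr \<rho> (M \<Otimes>\<^sub>M M) (\<lambda>y. (p, y))"
  have [measurable]: "(\<lambda>y. (p, y)) \<in> \<rho> \<rightarrow>\<^sub>M M \<Otimes>\<^sub>M M" by measurable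
  have \<pi>: "\<pi> \<in> couplings M \<mu>' \<rho>"
    unfolding couplings_def
  proof (safe)
    show "\<pi> \<in> finite_measures (M \<Otimes>\<^sub>M M)"
      using finite_measure.finite_measure_distr[OF fin_\<rho>, of "\<lambda>y. (p, y)" "M \<Otimes>\<^sub>M M"]
      by (auto simp: \<pi>_def finite_measures_def)
    have "distr \<pi> M snd = distr \<rho> M (\<lambda>y. y)"
      unfolding \<pi>_def by (subst distr_distr) (auto simp: comp_def)
    also have "\<dots> = \<rho>" by (simp add: distr_id2)
    finally show "distr \<pi> M snd = \<rho>" .
    have "distr \<pi> M fst = distr \<rho> M (\<lambda>y. p)"
      unfolding \<pi>_def by (subst distr_distr) (auto simp: comp_def)
    also have "\<dots> = \<mu>'"
    proof (rule measure_eqI)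
      fix A assume "A \<in> sets (distr \<rho> M (\<lambda>y. p))"
      then have A: "A \<in> sets M" by simp
      have "(\<lambda>y. p) -` A \<inter> space M = (if p \<in> A then space M else {})" by auto
      then have "emeasure (distr \<rho> M (\<lambda>y. p)) A = (if p \<in> A then ennreal m else 0)"
        using A by (subst emeasure_distr) (auto simp: finite_measures_emeasure[OF \<rho>] m)
      then show "emeasure (distr \<rho> M (\<lambda>y. p)) A = emeasure \<mu>' A"
        using A by (simp add: finite_measures_emeasure[OF \<mu>'(1)] \<mu>' indicator_def)
    qed (simp add: \<mu>'_def)
    finally show "distr \<pi> M fst = \<mu>'" .
  qed
  have "AE y in \<rho>. y \<in> B"
    using \<rho>B B by (intro AE_I'[of "space M - B"]) (auto simp: null_sets_def finite_measures_emeasure[OF \<rho>])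
  then have "AE z in \<pi>. z \<in> {p} \<times> B"
    unfolding \<pi>_def using p B by (subst AE_distr_iff) auto
  \<comment> \<open>Only monotonicity of \<open>nn_integral\<close> is used, which holds for a
    possibly nonmeasurable \<open>d\<close>.\<close>
  then have "(\<integral>\<^sup>+ (x, y). d x y \<partial>\<pi>) \<le> (\<integral>\<^sup>+ z. 1 \<partial>\<pi>)"
    by (intro nn_integral_mono_AE) (auto elim!: eventually_mono simp: d)
  also have "\<dots> = emeasure \<rho> (space M)"
    unfolding \<pi>_def by (subst nn_integral_distr) auto
  also have "\<dots> = ennreal m"
    by (simp add: finite_measures_emeasure[OF \<rho>] m)
  finally have "W1 M d \<mu>' \<rho> \<le> ennreal m"
    unfolding W1_def using \<pi> by (meson INF_lower order_trans)
  \<comment> \<open>\<open>ennreal\<close> truncates negative reals to 0, so both differences must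
    be nonnegative before the three costs can be merged into one.\<close>
  have ge: "0 \<le> measure \<mu> (space M) - m" "0 \<le> measure \<nu> (space M) - m"
    using \<mu>'\<mu>[of "space M"] \<rho>\<nu>[of "space M"] m by (auto simp: \<mu>')
  have "W1_gen M d \<mu> \<nu> \<le> ennreal (measure \<mu> (space M) - m) + ennreal (measure \<nu> (space M) - m) + W1 M d \<mu>' \<rho>"
    unfolding W1_gen_def
    by (rule INF_lower2[of "(\<mu>', \<rho>)"]) (use \<mu>' \<rho> mass tm tm' in auto)
  also have "\<dots> \<le> ennreal (measure \<mu> (space M) - m) + ennreal (measure \<nu> (space M) - m) + ennreal m"
    using \<open>W1 M d \<mu>' \<rho> \<le> _\<close> by (rule add_left_mono)
  also have "\<dots> = ennreal (measure \<mu> (space M) + measure \<nu> (space M) - m)"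
    using ge m0 by (simp flip: ennreal_plus)
  finally show ?thesis .
qed

text \<open>The whole argument for an abstract cost \<open>d\<close>: geometry enters only through a
  set \<open>B\<close> of positive mass reachable from \<open>p\<close> at cost at most 1.\<close>

lemma rival_wins_from_point:
  fixes d :: "'a \<Rightarrow> 'a \<Rightarrow> ennreal"
  assumes \<tau>: "\<tau> \<in> finite_measures M" "measure \<tau> (space M) = 1"
    and p: "{p} \<in> sets M" and B: "B \<in> sets M" "0 < measure \<tau> B" and d: "\<And>y. y \<in> B \<Longrightarrow> d p y \<le> 1"
  shows "\<exists>K::nat. K > 0 \<and> (\<forall>x. (\<forall>i\<ge>1. x i \<in> space M) \<longrightarrow>
      (\<forall>N. 1 \<le> N \<and> N \<le> N0 \<longrightarrow>
          W1_signed M d (\<lambda>A. 1 / (2 * real N + real K) * shop_measure M x (\<lambda>_. p) K N A) (measure \<tau>)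
          > W1_signed M d (\<lambda>A. 1 / (2 * real N + real K) * (- shop_measure M x (\<lambda>_. p) K N A)) (measure \<tau>)))"
proof -
  have p_space: "p \<in> space M" using sets.sets_into_space[OF p] by auto
  define \<beta> where "\<beta> = measure \<tau> B"
  \<comment> \<open>The cap \<open>\<beta>\<close> lets a measure of mass \<open>m\<close> on
    \<open>B\<close> fit below \<open>\<tau>\<close>; the cap 1/2 lets mass \<open>m\<close> be
    taken from \<open>p\<close> for the \<open>K\<close> chosen next.\<close>
  define m where "m = min \<beta> (1/2)"
  have m: "0 < m" "m \<le> \<beta>" "m \<le> 1/2" using B by (auto simp: m_def \<beta>_def)
  \<comment> \<open>Chosen so that \<open>2 * real N0 < m * real K\<close>; the summand 1 makes this
    strict and \<open>K\<close> positive.\<close>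
  define K where "K = nat \<lceil>2 * real N0 / m\<rceil> + 1"
  have K: "2 * real N0 / m < real K" "K > 0" unfolding K_def by linarith+
  show ?thesis
  proof (intro exI[of _ K] conjI allI impI, fact, elim conjE)
    fix x :: "nat \<Rightarrow> 'a" and N assume x: "\<forall>i\<ge>1. x i \<in> space M" and N: "1 \<le> N" "N \<le> N0"
    define c where "c = 1 / (2 * real N + real K)"
    have c: "0 < c" "c * (2 * real N + real K) = 1" using N by (auto simp: c_def)
    have "2 * real N / m < real K"
    proof -
      have "2 * real N / m \<le> 2 * real N0 / m" using N m by (intro divide_right_mono) auto
      with K show ?thesis by simp
    qed
    then have NK: "2 * real N < m * real K" using m by (simp add: divide_simps mult.commute)
    \<comment> \<open>Since \<open>m \<le> 1/2\<close>, the same choice of \<open>K\<close> also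
      gives 4N < K, from which \<open>c * real K\<close> is at least 1/2.\<close>
    also have "\<dots> \<le> 1/2 * real K" using m by (intro mult_right_mono) auto
    finally have NK': "4 * real N < real K" by simp
    define \<sigma> where "\<sigma> = (\<lambda>A. c * shop_measure M x (\<lambda>_. p) K N A)"
    define xs where "xs A = (\<Sum>i=1..N. measure (return M (x i)) A)" for A
    obtain \<alpha>0 where \<alpha>0: "\<alpha>0 \<in> finite_measures M" "\<And>A. A \<in> sets M \<Longrightarrow> measure \<alpha>0 A = xs A"
      using sum_finite_measures[of "{1..N}" "\<lambda>i. return M (x i)" M] x
      unfolding xs_def by (metis atLeastAtMost_iff finite_atLeastAtMost return_finite_measures)
    \<comment> \<open>\<open>\<alpha>\<close> and \<open>\<kappa>\<close> are the scaled shops of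
      the two sides. They overlap when some \<open>x i\<close> equals \<open>p\<close>, so in
      general they are not the Jordan parts \<open>\<mu>\<close>, \<open>\<nu>\<close> of
      \<open>\<sigma>\<close>, but their masses bound those of the parts.\<close>
    define \<alpha> where "\<alpha> = scale_measure (ennreal c) \<alpha>0"
    have \<alpha>: "\<alpha> \<in> finite_measures M" "\<And>A. A \<in> sets M \<Longrightarrow> measure \<alpha> A = c * xs A"
      using scale_finite_measures[OF \<alpha>0(1), of c] c \<alpha>0 by (auto simp: \<alpha>_def)
    define \<kappa> where "\<kappa> = scale_measure (ennreal (c * real (N + K))) (return M p)"
    have \<kappa>: "\<kappa> \<in> finite_measures M" "\<And>A. A \<in> sets M \<Longrightarrow> measure \<kappa> A = c * real (N + K) * indicator A p"
      using scale_finite_measures[OF return_finite_measures[OF p_space], of "c * real (N + K)"] c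
      by (auto simp: \<kappa>_def measure_return)
    have \<sigma>: "\<sigma> A = measure \<alpha> A - measure \<kappa> A" if "A \<in> sets M" for A
      unfolding \<sigma>_def shop_measure_def xs_def[symmetric]
      using that by (simp add: \<alpha> \<kappa> measure_return right_diff_distrib)
    obtain \<mu> \<nu> where J: "jordan_decomposition M \<sigma> \<mu> \<nu>"
      using jordan_decomposition_exists[OF \<alpha>(1) \<kappa>(1) \<sigma>] by blast
    then have \<mu>\<nu>: "\<mu> \<in> finite_measures M" "\<nu> \<in> finite_measures M"
      "\<And>A. A \<in> sets M \<Longrightarrow> \<sigma> A = measure \<mu> A - measure \<nu> A"
      by (auto simp: jordan_decomposition_def)
    obtain P where P: "P \<in> sets M" "\<And>A. A \<in> sets M \<Longrightarrow> measure \<mu> A = \<sigma> (A \<inter> P)"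
        "\<And>A. A \<in> sets M \<Longrightarrow> measure \<nu> A = - \<sigma> (A - P)"
      using jordan_decomposition_restrict[OF J] by auto
    note null = null_measure_finite_measures[of M]
    note add = add_measure_finite_measures
    have nullm: "measure (null_measure M) A = 0" for A by (simp add: measure_def)
    have xs_space: "xs (space M) = real N"
      unfolding xs_def using x by (simp add: measure_return)
    have \<alpha>_space: "measure \<alpha> (space M) = c * real N"
      by (simp add: \<alpha> xs_space)
    have \<kappa>_space: "measure \<kappa> (space M) = c * real (N + K)"
      using p_space by (simp add: \<kappa>)

    \<comment> \<open>The difference of the masses of \<open>\<nu>\<close> and \<open>\<mu>\<close>
      is \<open>- \<sigma> (space M)\<close>, which is unaffected by cancellation at
      \<open>p\<close>.\<close>
    have "1 + c * real K = measure \<nu> (space M) + measure \<tau> (space M) - measure \<mu> (space M)"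
      using \<mu>\<nu>(3)[of "space M"] \<sigma>[of "space M"] \<tau>(2) by (simp add: \<alpha>_space \<kappa>_space algebra_simps)
    also have "ennreal \<dots> \<le> W1_gen M d (add_measure \<mu> (null_measure M)) (add_measure \<nu> \<tau>)"
      using W1_gen_ge_mass_difference[OF add(1)[OF \<mu>\<nu>(1) null] add(1)[OF \<mu>\<nu>(2) \<tau>(1)], of d]
      by (simp add: add(2)[OF \<mu>\<nu>(1) null] add(2)[OF \<mu>\<nu>(2) \<tau>(1)] nullm)
    also have "\<dots> = W1_signed M d \<sigma> (measure \<tau>)"
      unfolding W1_signed_def
      by (simp add: jordan_decomposition_parts[OF J] positive_measure_parts[OF \<tau>(1)])
    finally have lower: "ennreal (1 + c * real K) \<le> W1_signed M d \<sigma> (measure \<tau>)" .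

    \<comment> \<open>The part of \<open>\<tau>\<close> in \<open>B\<close>, scaled to mass
      \<open>m\<close>; the factor is at most 1, so \<open>\<rho>\<close> stays below
      \<open>\<tau>\<close>.\<close>
    define \<rho> where "\<rho> = scale_measure (ennreal (m / \<beta>)) (density \<tau> (indicator B))"
    have \<rho>: "\<rho> \<in> finite_measures M" "\<And>A. A \<in> sets M \<Longrightarrow> measure \<rho> A = m / \<beta> * measure \<tau> (A \<inter> B)"
      using scale_finite_measures[OF density_indicator_finite_measures(1)[OF \<tau>(1) B(1)], of "m / \<beta>"] m
        density_indicator_finite_measures(2)[OF \<tau>(1) B(1)]
      by (auto simp: \<rho>_def)
    have \<rho>_le: "measure \<rho> A \<le> measure \<tau> A" if "A \<in> sets M" for A
    proof -
      have "m / \<beta> * measure \<tau> (A \<inter> B) \<le> 1 * measure \<tau> A"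
        using m that by (intro mult_mono finite_measures_mono[OF \<tau>(1)]) auto
      then show ?thesis using that by (simp add: \<rho>)
    qed
    have "measure \<mu> (space M) \<le> measure \<alpha> (space M)"
    proof -
      have "measure \<mu> (space M) = measure \<alpha> (space M \<inter> P) - measure \<kappa> (space M \<inter> P)"
        using P(1) by (simp add: P(2) \<sigma>)
      also have "\<dots> \<le> measure \<alpha> (space M)"
        using finite_measures_mono[OF \<alpha>(1) Int_lower1 sets.top, of P] measure_nonneg[of \<kappa> "space M \<inter> P"]
        by linarith
      finally show ?thesis .
    qed
    moreover have "measure \<nu> (space M) \<le> measure \<kappa> (space M)"
    proof -
      have "measure \<nu> (space M) = measure \<kappa> (space M - P) - measure \<alpha> (space M - P)"
        using P(1) by (simp add: P(3) \<sigma>)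
      also have "\<dots> \<le> measure \<kappa> (space M)"
        using finite_measures_mono[OF \<kappa>(1) Diff_subset sets.top, of P] measure_nonneg[of \<alpha> "space M - P"]
        by linarith
      finally show ?thesis .
    qed
    \<comment> \<open>The masses of \<open>\<alpha>\<close> and \<open>\<kappa>\<close> add up to
      c(2N+K) = 1, and cancellation can only lower the sum for \<open>\<mu>\<close> and
      \<open>\<nu>\<close>.\<close>
    ultimately have mass: "measure \<nu> (space M) + measure \<mu> (space M) \<le> 1"
      using c(2) by (simp add: \<alpha>_space \<kappa>_space algebra_simps)
    have "m \<le> c * real K"
    proof -
      have "1 \<le> 2 * (c * real K)"
        using mult_strict_left_mono[OF NK' c(1)] c(2) by (simp add: algebra_simps)
      then show ?thesis using m by simp
    qed
    \<comment> \<open>Worst case: all N of our shops sit on \<open>p\<close> and cancel N of the N+K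
      rival shops there.\<close>
    also have "c * real K \<le> - \<sigma> {p}"
    proof -
      have "xs {p} \<le> real N"
        using finite_measures_mono[OF \<alpha>0(1), of "{p}" "space M"] p_space p by (simp add: \<alpha>0 xs_space)
      then have "c * xs {p} \<le> c * real N" using c by simp
      then show ?thesis using p by (simp add: \<sigma> \<alpha> \<kappa> algebra_simps)
    qed
    also have "\<dots> \<le> measure \<nu> {p}" using p by (simp add: \<mu>\<nu>(3))
    finally have m_le: "m \<le> measure \<nu> {p}" .
    have "W1_signed M d (\<lambda>A. - \<sigma> A) (measure \<tau>) = W1_gen M d (add_measure \<nu> (null_measure M)) (add_measure \<mu> \<tau>)"
      unfolding W1_signed_def
      by (simp add: jordan_decomposition_parts[OF jordan_decomposition_uminus[OF J]] positive_measure_parts[OF \<tau>(1)])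
    also have "\<dots> \<le> ennreal (measure (add_measure \<nu> (null_measure M)) (space M) + measure (add_measure \<mu> \<tau>) (space M) - m)"
    proof (rule W1_gen_le_transport_from_point[where \<rho> = \<rho> and B = B and p = p])
      show "measure \<rho> A \<le> measure (add_measure \<mu> \<tau>) A" if "A \<in> sets M" for A
        using \<rho>_le[OF that] that by (simp add: add(2)[OF \<mu>\<nu>(1) \<tau>(1)] add_increasing)
      show "measure \<rho> (space M - B) = 0"
        using B(1) by (simp add: \<rho>(2) Diff_Int_distrib2)
      have "space M \<inter> B = B" using sets.sets_into_space[OF B(1)] by auto
      then show "measure \<rho> (space M) = m"
        using B(2) by (simp add: \<rho> \<beta>_def)
      show "m \<le> measure (add_measure \<nu> (null_measure M)) {p}"
        using m_le p by (simp add: add(2)[OF \<mu>\<nu>(2) null] nullm)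
    qed (use add(1)[OF \<mu>\<nu>(2) null] add(1)[OF \<mu>\<nu>(1) \<tau>(1)] \<rho> p B d in auto)
    also have "\<dots> \<le> ennreal (2 - m)"
      using mass by (intro ennreal_leI) (simp add: add(2)[OF \<mu>\<nu>(2) null] add(2)[OF \<mu>\<nu>(1) \<tau>(1)] nullm \<tau>(2))
    \<comment> \<open>As 1 + cK = 2 - 2Nc, the claim amounts to 2Nc < m; this follows from 2N < mK
      after multiplying by c, because cK is at most 1.\<close>
    also have "\<dots> < ennreal (1 + c * real K)"
    proof (rule ennreal_lessI)
      show "0 < 1 + c * real K" using c by (simp add: add_pos_nonneg)
      have "c * (2 * real N) < c * (m * real K)" using NK c by simp
      also have "\<dots> = m * (c * real K)" by simp
      also have "c * real K \<le> c * (2 * real N + real K)" using c(1) by simp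
      finally have "c * (2 * real N) < m" using c(2) m by simp
      then show "2 - m < 1 + c * real K" using c(2) by (simp add: algebra_simps)
    qed
    also note lower
    finally show "W1_signed M d (\<lambda>A. 1 / (2 * real N + real K) * (- shop_measure M x (\<lambda>_. p) K N A)) (measure \<tau>)
        < W1_signed M d (\<lambda>A. 1 / (2 * real N + real K) * shop_measure M x (\<lambda>_. p) K N A) (measure \<tau>)"
      by (simp add: \<sigma>_def c_def)
  qed
qed

section \<open>Change of variables for arbitrary finite index types\<close>

text \<open>The library states the change of variables formula only for index types of class
  \<^class>\<open>wellorder\<close>; a copy of the index type, ordered by an arbitrary enumeration, removes this
  restriction.\<close>

typedef 'd ordered_copy = "UNIV :: 'd set" by auto

definition index_of :: "'d::finite \<Rightarrow> nat" where
  "index_of = (SOME h. inj h)"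

lemma inj_index_of: "inj index_of"
proof -
  have "\<exists>h :: 'd::finite \<Rightarrow> nat. inj h"
    using finite_imp_inj_to_nat_seg[of "UNIV :: 'd set"] by auto
  then show ?thesis unfolding index_of_def by (rule someI_ex)
qed

instance ordered_copy :: (finite) finite
proof
  have "(UNIV :: 'a ordered_copy set) = range Abs_ordered_copy"
    by (metis Rep_ordered_copy_inverse surjI)
  then show "finite (UNIV :: 'a ordered_copy set)"
    by (rule finite_subset[OF equalityD1]) (rule finite_imageI, rule finite)
qed

instantiation ordered_copy :: (finite) wellorder
begin

definition "a \<le> b \<longleftrightarrow> index_of (Rep_ordered_copy a) \<le> index_of (Rep_ordered_copy b)"

definition "a < b \<longleftrightarrow> index_of (Rep_ordered_copy a) < index_of (Rep_ordered_copy b)"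

instance
proof
  fix x y z :: "'a ordered_copy"
  show "x < y \<longleftrightarrow> x \<le> y \<and> \<not> y \<le> x" "x \<le> x" "x \<le> y \<Longrightarrow> y \<le> z \<Longrightarrow> x \<le> z" "x \<le> y \<or> y \<le> x"
    by (auto simp: less_eq_ordered_copy_def less_ordered_copy_def)
  show "x \<le> y \<Longrightarrow> y \<le> x \<Longrightarrow> x = y"
    unfolding less_eq_ordered_copy_def
    by (metis Rep_ordered_copy_inject injD inj_index_of order_antisym)
next
  fix P :: "'a ordered_copy \<Rightarrow> bool" and a
  assume step: "\<And>x. (\<And>y. y < x \<Longrightarrow> P y) \<Longrightarrow> P x"
  show "P a"
  proof (induction "index_of (Rep_ordered_copy a)" arbitrary: a rule: less_induct)
    case less
    show ?case
      by (rule step, rule less) (simp add: less_ordered_copy_def)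
  qed
qed

end

text \<open>Rows and columns are relabelled by the same bijection. Conjugation by \<open>f\<close>
  maps the permutations of one index set bijectively onto those of the other and preserves signs, so
  the Leibniz sums match term by term.\<close>

lemma det_reindex:
  fixes A :: "'a::comm_ring_1 ^ 'n::finite ^ 'n" and f :: "'m::finite \<Rightarrow> 'n"
  assumes f: "bij f"
  shows "det (\<chi> i j. A $ f i $ f j) = det A"
proof -
  let ?\<Phi> = "map_permutation UNIV f"
  have inj: "inj f" using f by (rule bij_is_inj)
  have map: "?\<Phi> p = f \<circ> p \<circ> inv f" for p
    using bij_is_surj[OF f] by (simp add: map_permutation_def restrict_id_def fun_eq_iff)
  have "bij_betw ?\<Phi> {p. p permutes UNIV} {p. p permutes UNIV}"
  proof (rule bij_betw_byWitness[where f' = "map_permutation UNIV (inv f)"])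
    have 1: "map_permutation UNIV (inv f) q = inv f \<circ> q \<circ> f" for q
      using f by (simp add: map_permutation_def bij_imp_bij_inv bij_is_surj inv_inv_eq restrict_id_def fun_eq_iff)
    show "\<forall>p\<in>{p. p permutes UNIV}. map_permutation UNIV (inv f) (?\<Phi> p) = p"
      "\<forall>q\<in>{q. q permutes UNIV}. ?\<Phi> (map_permutation UNIV (inv f) q) = q"
      using f by (auto simp: 1 map fun_eq_iff bij_is_inj bij_is_surj surj_f_inv_f)
    show "?\<Phi> ` {p. p permutes UNIV} \<subseteq> {p. p permutes UNIV}"
      using map_permutation_permutes[OF f] by auto
    show "map_permutation UNIV (inv f) ` {p. p permutes UNIV} \<subseteq> {p. p permutes UNIV}"
      using map_permutation_permutes[OF bij_imp_bij_inv[OF f]] by auto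
  qed
  then have "det A = (\<Sum>p | p permutes (UNIV :: 'm set). of_int (sign (?\<Phi> p)) * (\<Prod>i\<in>UNIV. A $ i $ ?\<Phi> p i))"
    unfolding det_def by (subst sum.reindex_bij_betw[symmetric]) auto
  also have "\<dots> = (\<Sum>p | p permutes (UNIV :: 'm set). of_int (sign p) * (\<Prod>i\<in>UNIV. A $ f i $ f (p i)))"
  proof (intro sum.cong refl)
    fix p :: "'m \<Rightarrow> 'm" assume "p \<in> {p. p permutes UNIV}"
    then have "sign (?\<Phi> p) = sign p" by (intro sign_map_permutation inj) auto
    moreover have "(\<Prod>i\<in>UNIV. A $ i $ ?\<Phi> p i) = (\<Prod>i\<in>UNIV. A $ f i $ ?\<Phi> p (f i))"
      by (rule prod.reindex_bij_betw[OF f, symmetric])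
    ultimately show "of_int (sign (?\<Phi> p)) * (\<Prod>i\<in>UNIV. A $ i $ ?\<Phi> p i)
        = of_int (sign p) * (\<Prod>i\<in>UNIV. A $ f i $ f (p i))"
      by (simp add: map inj)
  qed
  also have "\<dots> = det (\<chi> i j. A $ f i $ f j)"
    by (simp add: det_def)
  finally show ?thesis ..
qed

section \<open>Change of variables for nonnegative integrands\<close>

text \<open>Absolute integrability refers to the completion of \<open>lborel\<close>. Borel
  measurability of the integrand cut off by the indicator permits the passage to
  \<open>lborel\<close> itself.\<close>

lemma absolutely_integrable_on_iff_set_nn_integral:
  fixes f :: "'a::euclidean_space \<Rightarrow> real"
  assumes meas: "(\<lambda>x. indicator S x * f x) \<in> borel_measurable borel" and nonneg: "\<And>x. x \<in> S \<Longrightarrow> 0 \<le> f x"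
  shows "f absolutely_integrable_on S \<longleftrightarrow> (\<integral>\<^sup>+x\<in>S. ennreal (f x) \<partial>lborel) < \<infinity>"
proof -
  have "f absolutely_integrable_on S \<longleftrightarrow> integrable lborel (\<lambda>x. indicator S x * f x)"
    unfolding set_integrable_def using meas by (simp add: integrable_completion)
  also have "\<dots> \<longleftrightarrow> (\<integral>\<^sup>+x. ennreal (norm (indicator S x * f x)) \<partial>lborel) < \<infinity>"
    using meas by (simp add: integrable_iff_bounded)
  also have "(\<integral>\<^sup>+x. ennreal (norm (indicator S x * f x)) \<partial>lborel) = (\<integral>\<^sup>+x\<in>S. ennreal (f x) \<partial>lborel)"
    using nonneg by (intro nn_integral_cong) (auto simp: indicator_def)
  finally show ?thesis .
qed

lemma set_nn_integral_eq_integral: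
  fixes f :: "'a::euclidean_space \<Rightarrow> real"
  assumes "f absolutely_integrable_on S" and nonneg: "\<And>x. x \<in> S \<Longrightarrow> 0 \<le> f x"
  shows "(\<integral>\<^sup>+x\<in>S. ennreal (f x) \<partial>lborel) = ennreal (integral S f)"
proof -
  have "(\<integral>\<^sup>+x\<in>S. ennreal (f x) \<partial>lborel) = (\<integral>\<^sup>+x. ennreal (indicator S x * f x) \<partial>lborel)"
    by (intro nn_integral_cong) (auto simp: indicator_def)
  also have "\<dots> = ennreal (integral S f)"
    using assms by (intro nn_integral_has_integral_lebesgue)
      (auto intro: integrable_integral set_lebesgue_integral_eq_integral)
  finally show ?thesis .
qed

text \<open>Either both sides are finite and the integrable formula applies, or neither integrand is
  integrable. In the latter case \<open>meas\<close> and \<open>meas'\<close> ensure that both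
  integrals are infinite.\<close>

lemma nn_integral_change_of_variables_wellorder:
  fixes f :: "real^'m::{finite,wellorder} \<Rightarrow> real" and g :: "real^'m::_ \<Rightarrow> real^'m::_"
  assumes S: "S \<in> sets borel"
    and der: "\<And>x. x \<in> S \<Longrightarrow> (g has_derivative g' x) (at x within S)" and inj: "inj_on g S"
    and nonneg: "\<And>y. y \<in> g ` S \<Longrightarrow> 0 \<le> f y"
    and meas: "(\<lambda>y. indicator (g ` S) y * f y) \<in> borel_measurable borel"
    and meas': "(\<lambda>x. indicator S x * (\<bar>det (matrix (g' x))\<bar> * f (g x))) \<in> borel_measurable borel"
  shows "(\<integral>\<^sup>+y\<in>g ` S. ennreal (f y) \<partial>lborel) = (\<integral>\<^sup>+x\<in>S. ennreal (\<bar>det (matrix (g' x))\<bar> * f (g x)) \<partial>lborel)"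
proof -
  let ?F = "\<lambda>x. \<bar>det (matrix (g' x))\<bar> * f (g x)"
  \<comment> \<open>A real function enters the vector-valued formula as a function into
    \<open>real ^ 1\<close>. The equivalence transfers integrability together with the
    value.\<close>
  have cov: "?F absolutely_integrable_on S \<and> integral S ?F = b \<longleftrightarrow>
      f absolutely_integrable_on (g ` S) \<and> integral (g ` S) f = b" for b
  proof -
    have "(\<lambda>x. \<bar>det (matrix (g' x))\<bar> *\<^sub>R vec (f(g x)) :: real ^ 1) absolutely_integrable_on S \<and>
           integral S (\<lambda>x. \<bar>det (matrix (g' x))\<bar> *\<^sub>R vec (f(g x))) = (vec b :: real ^ 1)
         \<longleftrightarrow> (\<lambda>x. vec (f x) :: real ^ 1) absolutely_integrable_on (g ` S) \<and>
           integral (g ` S) (\<lambda>x. vec (f x)) = (vec b :: real ^ 1)"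
      using S der inj by (intro has_absolute_integral_change_of_variables) auto
    then show ?thesis
      by (simp add: absolutely_integrable_on_1_iff integral_on_1_eq)
  qed
  have nonneg': "0 \<le> ?F x" if "x \<in> S" for x
    using nonneg that by auto
  show ?thesis
  proof (cases "f absolutely_integrable_on (g ` S)")
    case True
    then have "?F absolutely_integrable_on S \<and> integral S ?F = integral (g ` S) f"
      using cov by blast
    with True show ?thesis
      using nonneg nonneg' by (simp add: set_nn_integral_eq_integral)
  next
    case False
    then have "\<not> ?F absolutely_integrable_on S" using cov by blast
    with False have "(\<integral>\<^sup>+y\<in>g ` S. ennreal (f y) \<partial>lborel) = \<infinity>" "(\<integral>\<^sup>+x\<in>S. ennreal (?F x) \<partial>lborel) = \<infinity>"
      using absolutely_integrable_on_iff_set_nn_integral[OF meas nonneg]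
        absolutely_integrable_on_iff_set_nn_integral[OF meas' nonneg']
      by (simp_all add: less_top[symmetric])
    then show ?thesis by simp
  qed
qed

section \<open>Relabelling of coordinates\<close>

definition reindex :: "('m \<Rightarrow> 'n) \<Rightarrow> real ^ 'n \<Rightarrow> real ^ 'm" where
  "reindex h v = (\<chi> i. v $ h i)"

lemma linear_reindex: "linear (reindex h)"
  by (auto intro!: linearI simp: reindex_def vec_eq_iff)

lemma reindex_measurable [measurable]:
  "(reindex h :: real ^ 'n::finite \<Rightarrow> real ^ 'm::finite) \<in> borel_measurable borel"
  using linear_continuous_on linear_reindex linear_linear
  by (intro borel_measurable_continuous_onI) blast

lemma reindex_reindex: "bij h \<Longrightarrow> reindex h (reindex (inv h) v) = v"
  "bij h \<Longrightarrow> reindex (inv h) (reindex h w) = w"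
  by (auto simp: reindex_def vec_eq_iff bij_is_inj bij_is_surj surj_f_inv_f)

text \<open>\<open>lborel\<close> is determined by its values on boxes, and relabelling sends a box
  to a box with the same side lengths in another order.\<close>

lemma distr_reindex_lborel:
  fixes h :: "'m::finite \<Rightarrow> 'n::finite"
  assumes h: "bij h"
  shows "distr lborel borel (reindex h) = (lborel :: (real ^ 'm) measure)"
proof (rule lborel_eqI[symmetric])
  fix l u :: "real ^ 'm" assume lu: "\<And>b. b \<in> Basis \<Longrightarrow> l \<bullet> b \<le> u \<bullet> b"
  let ?r = "reindex (inv h) :: real ^ 'm \<Rightarrow> real ^ 'n"
  have le: "l $ i \<le> u $ i" for i using lu[of "axis i 1"] by (simp add: inner_axis)
  have eq: "reindex h -` box l u = box (?r l) (?r u)"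
  proof (rule set_eqI)
    fix x :: "real ^ 'n"
    have "(\<forall>i. l $ i < x $ h i \<and> x $ h i < u $ i) \<longleftrightarrow> (\<forall>j. l $ inv h j < x $ j \<and> x $ j < u $ inv h j)"
      using h by (metis bij_inv_eq_iff)
    then show "x \<in> reindex h -` box l u \<longleftrightarrow> x \<in> box (?r l) (?r u)"
      by (simp add: mem_box_cart reindex_def)
  qed
  have le': "?r l \<bullet> b \<le> ?r u \<bullet> b" if "b \<in> Basis" for b
    using that le by (auto simp: Basis_vec_def inner_axis reindex_def)
  have "emeasure (distr lborel borel (reindex h)) (box l u) = emeasure lborel (box (?r l) (?r u))"
    by (subst emeasure_distr) (auto simp: eq)
  also have "\<dots> = ennreal (\<Prod>b\<in>Basis. (?r u - ?r l) \<bullet> b)"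
    using le' by (intro emeasure_lborel_box)
  also have "(\<Prod>b\<in>Basis. (?r u - ?r l) \<bullet> b) = (\<Prod>j\<in>UNIV. u $ inv h j - l $ inv h j)"
    by (simp add: Basis_vec_def prod.UNION_disjoint axis_eq_axis inner_axis reindex_def)
  also have "\<dots> = (\<Prod>i\<in>UNIV. u $ i - l $ i)"
    using h by (intro prod.reindex_bij_betw bij_imp_bij_inv)
  also have "\<dots> = (\<Prod>b\<in>Basis. (u - l) \<bullet> b)"
    by (simp add: Basis_vec_def prod.UNION_disjoint axis_eq_axis inner_axis)
  finally show "emeasure (distr lborel borel (reindex h)) (box l u) = ennreal (\<Prod>b\<in>Basis. (u - l) \<bullet> b)" .
qed simp

text \<open>Relabelling moves the j-th unit vector to the \<open>h j\<close>-th, so conjugating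
  \<open>L\<close> permutes rows and columns alike; \<open>det_reindex\<close> then shows that the
  Jacobian is unchanged.\<close>

lemma matrix_reindex:
  assumes "linear L" "bij h"
  shows "matrix (reindex h \<circ> L \<circ> reindex (inv h)) = (\<chi> i j. matrix L $ h i $ h j)"
proof -
  have "reindex (inv h) (axis j 1) = axis (h j) 1" for j
  proof -
    have "inv h i = j \<longleftrightarrow> i = h j" for i
      using bij_inv_eq_iff[OF assms(2), of j i] by metis
    then show ?thesis by (simp add: reindex_def axis_def vec_eq_iff)
  qed
  then show ?thesis by (simp add: matrix_def reindex_def vec_eq_iff)
qed

text \<open>The map, its derivative and the integrand are conjugated to the ordered copy of the
  index type; there the formula is available, and relabelling preserves both Lebesgue measure and
  Jacobians.\<close>

lemma nn_integral_change_of_variables: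
  fixes f :: "real^'d::finite \<Rightarrow> real" and g :: "real^'d \<Rightarrow> real^'d"
  assumes S: "S \<in> sets borel"
    and der: "\<And>x. x \<in> S \<Longrightarrow> (g has_derivative g' x) (at x within S)" and inj: "inj_on g S"
    and nonneg: "\<And>y. y \<in> g ` S \<Longrightarrow> 0 \<le> f y"
    and meas: "(\<lambda>y. indicator (g ` S) y * f y) \<in> borel_measurable borel"
    and meas': "(\<lambda>x. indicator S x * (\<bar>det (matrix (g' x))\<bar> * f (g x))) \<in> borel_measurable borel"
  shows "(\<integral>\<^sup>+y\<in>g ` S. ennreal (f y) \<partial>lborel) = (\<integral>\<^sup>+x\<in>S. ennreal (\<bar>det (matrix (g' x))\<bar> * f (g x)) \<partial>lborel)"
proof -
  let ?h = "Rep_ordered_copy :: 'd ordered_copy \<Rightarrow> 'd"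
  have h: "bij ?h"
    by (metis Abs_ordered_copy_inverse Rep_ordered_copy_inverse UNIV_I bijI')
  let ?Q = "reindex ?h" and ?P = "reindex (inv ?h)"
  have QP: "?Q (?P v) = v" "?P (?Q w) = w" for v w by (rule reindex_reindex[OF h])+
  define G where "G = ?Q \<circ> g \<circ> ?P"
  define G' where "G' x = ?Q \<circ> g' (?P x) \<circ> ?P" for x
  define F where "F = f \<circ> ?P"
  have image: "G ` (?Q ` S) = ?Q ` (g ` S)"
    by (simp add: G_def image_image QP)
  have mem: "x \<in> ?Q ` T \<longleftrightarrow> ?P x \<in> T" for x T
    using QP by (metis image_iff)
  have ind: "indicator (?Q ` T) x = indicator T (?P x)" for x T
    by (simp add: indicator_def mem)
  have lin: "linear (g' x)" if "x \<in> S" for x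
    using der[OF that] by (rule has_derivative_linear)
  \<comment> \<open>The derivatives are known to be linear only over \<open>S\<close>, so Jacobians
    are compared under the indicator of the domain.\<close>
  have det: "det (matrix (G' x)) = det (matrix (g' (?P x)))" if "?P x \<in> S" for x
    unfolding G'_def by (simp add: matrix_reindex[OF lin[OF that] h] det_reindex[OF h])
  have cov: "(\<integral>\<^sup>+y\<in>G ` (?Q ` S). ennreal (F y) \<partial>lborel) = (\<integral>\<^sup>+x\<in>?Q ` S. ennreal (\<bar>det (matrix (G' x))\<bar> * F (G x)) \<partial>lborel)"
  proof (rule nn_integral_change_of_variables_wellorder)
    have "?Q ` S = ?P -` S" using mem by blast
    then show "?Q ` S \<in> sets borel"
      using measurable_sets[OF reindex_measurable S, of "inv ?h"] by simp
    show "inj_on G (?Q ` S)"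
      unfolding G_def using inj by (auto simp: inj_on_def QP) (metis QP(2))
    show "0 \<le> F y" if "y \<in> G ` (?Q ` S)" for y
      using that nonneg by (auto simp: F_def image QP)
    have "(\<lambda>y. indicator (G ` (?Q ` S)) y * F y) = (\<lambda>y. indicator (g ` S) y * f y) \<circ> ?P"
      by (simp add: fun_eq_iff image ind F_def)
    then show "(\<lambda>y. indicator (G ` (?Q ` S)) y * F y) \<in> borel_measurable borel"
      using measurable_comp[OF reindex_measurable meas] by simp
    have "(\<lambda>x. indicator (?Q ` S) x * (\<bar>det (matrix (G' x))\<bar> * F (G x)))
        = (\<lambda>x. indicator S x * (\<bar>det (matrix (g' x))\<bar> * f (g x))) \<circ> ?P"
    proof
      fix x
      show "indicator (?Q ` S) x * (\<bar>det (matrix (G' x))\<bar> * F (G x))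
        = ((\<lambda>x. indicator S x * (\<bar>det (matrix (g' x))\<bar> * f (g x))) \<circ> ?P) x"
        by (cases "?P x \<in> S") (simp_all add: ind F_def G_def QP det)
    qed
    then show "(\<lambda>x. indicator (?Q ` S) x * (\<bar>det (matrix (G' x))\<bar> * F (G x))) \<in> borel_measurable borel"
      using measurable_comp[OF reindex_measurable meas'] by simp
    show "(G has_derivative G' x) (at x within ?Q ` S)" if "x \<in> ?Q ` S" for x
    proof -
      have x: "?P x \<in> S" using that by (simp add: mem)
      have PQS: "?P ` ?Q ` S = S" by (simp add: image_image QP)
      have P: "(?P has_derivative ?P) (at x within ?Q ` S)" and Q: "(?Q has_derivative ?Q) (at y within T)" for y T
        by (auto intro!: linear_imp_has_derivative linear_reindex)
      have "(g \<circ> ?P has_derivative g' (?P x) \<circ> ?P) (at x within ?Q ` S)"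
        using der[OF x] by (intro diff_chain_within P) (simp add: PQS)
      from diff_chain_within[OF this Q] show ?thesis
        by (simp add: G_def G'_def[abs_def] comp_assoc)
    qed
  qed
  \<comment> \<open>Carries integrals over the ordered copy back to the original coordinates, once
    for each side of the formula.\<close>
  have transfer: "(\<integral>\<^sup>+y\<in>?Q ` T. ennreal (u (?P y)) \<partial>lborel) = (\<integral>\<^sup>+y\<in>T. ennreal (u y) \<partial>lborel)"
    if "(\<lambda>x. indicator T x * u x) \<in> borel_measurable borel" for T and u :: "real ^ 'd \<Rightarrow> real"
  proof -
    have *: "ennreal (u x) * indicator T x = ennreal (indicator T x * u x)" for x
      by (simp add: indicator_def)
    have meas_u: "(\<lambda>y. ennreal (u y) * indicator T y) \<in> borel_measurable borel"
      unfolding * by (rule measurable_compose[OF that measurable_ennreal])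
    have "(\<integral>\<^sup>+y\<in>T. ennreal (u y) \<partial>lborel) = (\<integral>\<^sup>+y. ennreal (u y) * indicator T y \<partial>(distr lborel borel ?P))"
      by (simp only: distr_reindex_lborel[OF bij_imp_bij_inv[OF h]])
    also have "\<dots> = (\<integral>\<^sup>+y. ennreal (u (?P y)) * indicator T (?P y) \<partial>lborel)"
      by (rule nn_integral_distr) (use meas_u in simp_all)
    finally show ?thesis by (simp add: ind)
  qed
  have "(\<integral>\<^sup>+y\<in>g ` S. ennreal (f y) \<partial>lborel) = (\<integral>\<^sup>+y\<in>G ` (?Q ` S). ennreal (F y) \<partial>lborel)"
    using transfer[OF meas] by (simp add: image F_def)
  also note cov
  also have "(\<integral>\<^sup>+x\<in>?Q ` S. ennreal (\<bar>det (matrix (G' x))\<bar> * F (G x)) \<partial>lborel)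
    = (\<integral>\<^sup>+x\<in>?Q ` S. ennreal (\<bar>det (matrix (g' (?P x)))\<bar> * f (g (?P x))) \<partial>lborel)"
  proof (intro nn_integral_cong)
    fix x
    show "ennreal (\<bar>det (matrix (G' x))\<bar> * F (G x)) * indicator (?Q ` S) x
      = ennreal (\<bar>det (matrix (g' (?P x)))\<bar> * f (g (?P x))) * indicator (?Q ` S) x"
      by (cases "?P x \<in> S") (simp_all add: ind F_def G_def QP det)
  qed
  also have "\<dots> = (\<integral>\<^sup>+x\<in>S. ennreal (\<bar>det (matrix (g' x))\<bar> * f (g x)) \<partial>lborel)"
    by (rule transfer[OF meas'])
  finally show ?thesis .
qed

section \<open>Riemannian volume and distance\<close>

text \<open>The hypothesis says that G is congruent to H via M, G = M^T H M. For metrics this is the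
  transformation law, so the square roots of the determinants differ by the absolute
  Jacobian.\<close>

lemma inner_matrix_congruence:
  fixes G H M :: "real ^ 'n::finite ^ 'n"
  assumes "\<And>v w. v \<bullet> (G *v w) = (M *v v) \<bullet> (H *v (M *v w))"
  shows "det G = (det M)\<^sup>2 * det H"
proof -
  have "v \<bullet> (G *v w) = v \<bullet> ((transpose M ** H ** M) *v w)" for v w
  proof -
    have "(M *v v) \<bullet> (H *v (M *v w)) = (v v* transpose M) \<bullet> (H *v (M *v w))"
      by simp
    also have "\<dots> = v \<bullet> (transpose M *v (H *v (M *v w)))"
      by (rule dot_lmul_matrix)
    finally show ?thesis
      using assms by (simp add: matrix_vector_mul_assoc matrix_mul_assoc)
  qed
  then have "G *v w = (transpose M ** H ** M) *v w" for w
    by (metis vector_eq_ldot)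
  then have "G = transpose M ** H ** M"
    by (simp add: matrix_eq)
  then show ?thesis
    by (simp add: det_mul det_transpose power2_eq_square)
qed

lemma continuous_on_det [continuous_intros]:
  fixes A :: "'a::topological_space \<Rightarrow> real ^ 'n::finite ^ 'n"
  assumes "continuous_on S A"
  shows "continuous_on S (\<lambda>x. det (A x))"
  unfolding det_def using assms by (intro continuous_intros)

text \<open>The segment from the identity to \<open>G\<close> consists of positive definite, hence invertible,
  matrices, so the determinant does not change sign along it.\<close>

lemma det_positive_definite:
  fixes G :: "real ^ 'n::finite ^ 'n"
  assumes pos: "\<And>v. v \<noteq> 0 \<Longrightarrow> 0 < v \<bullet> (G *v v)"
  shows "0 < det G"
proof (rule ccontr)
  assume "\<not> 0 < det G"
  define A where "A t = (1 - t) *\<^sub>R mat 1 + t *\<^sub>R G" for t :: real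
  have mult: "A t *v v = (1 - t) *\<^sub>R v + t *\<^sub>R (G *v v)" for t v
    by (simp add: A_def matrix_vector_mult_add_rdistrib scaleR_matrix_vector_assoc[symmetric])
  have "continuous_on {0..1} (\<lambda>t. det (A t))"
    unfolding A_def by (intro continuous_intros)
  moreover have "det (A 1) \<le> 0" "0 \<le> det (A 0)"
    using \<open>\<not> 0 < det G\<close> by (simp_all add: A_def)
  ultimately obtain t where t: "0 \<le> t" "t \<le> 1" "det (A t) = 0"
    using IVT2'[of "\<lambda>t. det (A t)" 1 0 0] by auto
  then obtain v where v: "v \<noteq> 0" "A t *v v = 0"
    by (metis invertible_det_nz invertible_left_inverse matrix_left_invertible_ker)
  have "0 < (1 - t) * (v \<bullet> v) + t * (v \<bullet> (G *v v))"
  proof (cases "t = 0")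
    case False
    then show ?thesis using t pos[OF v(1)] by (intro add_nonneg_pos) auto
  qed (use v in simp)
  also have "\<dots> = v \<bullet> (A t *v v)" by (simp add: mult inner_add_right)
  finally show False by (simp add: v)
qed

lemma space_borel_of [simp]: "space (borel_of X) = topspace X"
  unfolding borel_of_def by (rule space_measure_of) (auto dest: openin_subset)

lemma openin_borel_of: "openin X U \<Longrightarrow> U \<in> sets (borel_of X)"
  unfolding borel_of_def by (subst sets_measure_of) (auto dest: openin_subset)

lemma singleton_borel_of:
  assumes "Hausdorff_space X" "p \<in> topspace X"
  shows "{p} \<in> sets (borel_of X)"
proof -
  have "openin X (topspace X - {p})"
    using closedin_Hausdorff_singleton[OF assms] by (simp add: closedin_def)
  then have "topspace X - (topspace X - {p}) \<in> sets (borel_of X)"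
    by (metis openin_borel_of sets.compl_sets space_borel_of)
  then show ?thesis using assms by (simp add: double_diff)
qed

section \<open>Charts as Borel isomorphisms and transition maps\<close>

context smooth_manifold
begin

lemma chart_inj: "(U, \<phi>) \<in> atlas \<Longrightarrow> inj_on \<phi> U"
  using homeomorphic_imp_injective_map[OF chart_homeomorphic] chart_domain[THEN openin_subset]
  by (simp add: topspace_subtopology Int_absorb1)

lemma chart_open_image:
  assumes "(U, \<phi>) \<in> atlas" "openin X W"
  shows "open (\<phi> ` (U \<inter> W))"
proof -
  have "openin (subtopology X U) (U \<inter> W)"
    using assms(2) by (simp add: openin_subtopology_Int2 Int_commute)
  then have "openin (top_of_set (\<phi> ` U)) (\<phi> ` (U \<inter> W))"
    using homeomorphic_imp_open_map[OF chart_homeomorphic[OF assms(1)]] by (simp add: open_map_def)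
  then show ?thesis
    using chart_image[OF assms(1)] by (simp add: openin_open_eq)
qed

lemma chart_open_preimage:
  assumes "(U, \<phi>) \<in> atlas" "open S"
  shows "openin X {x \<in> U. \<phi> x \<in> S}"
proof -
  note U = chart_domain[OF assms(1)]
  have "continuous_map (subtopology X U) (top_of_set (\<phi> ` U)) \<phi>"
    by (rule homeomorphic_imp_continuous_map[OF chart_homeomorphic[OF assms(1)]])
  then have "continuous_map (subtopology X U) euclidean \<phi>"
    by (simp add: continuous_map_in_subtopology)
  then have "openin (subtopology X U) {x \<in> topspace (subtopology X U). \<phi> x \<in> S}"
    using assms(2) by (intro openin_continuous_map_preimage) auto
  moreover have "topspace (subtopology X U) = U"
    using openin_subset[OF U] by auto
  ultimately show ?thesis using U openin_trans_full by metis
qed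

lemma chart_inv:
  assumes "(U, \<phi>) \<in> atlas" "y \<in> \<phi> ` U"
  shows "inv_into U \<phi> y \<in> U" "\<phi> (inv_into U \<phi> y) = y"
  using assms(2) by (auto intro: inv_into_into f_inv_into_f)

lemma chart_inv_vimage:
  assumes "(U, \<phi>) \<in> atlas"
  shows "{y \<in> \<phi> ` U. inv_into U \<phi> y \<in> W} = \<phi> ` (U \<inter> W)"
proof (intro equalityI subsetI)
  fix y assume "y \<in> {y \<in> \<phi> ` U. inv_into U \<phi> y \<in> W}"
  then have "inv_into U \<phi> y \<in> U \<inter> W" "y = \<phi> (inv_into U \<phi> y)"
    using chart_inv[OF assms, of y] by simp_all
  then show "y \<in> \<phi> ` (U \<inter> W)" by (rule rev_image_eqI)
next
  fix y assume "y \<in> \<phi> ` (U \<inter> W)"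
  then show "y \<in> {y \<in> \<phi> ` U. inv_into U \<phi> y \<in> W}"
    using chart_inj[OF assms] by (auto simp: inv_into_f_f)
qed

lemma chart_inv_continuous:
  assumes "(U, \<phi>) \<in> atlas"
  shows "continuous_map (top_of_set (\<phi> ` U)) X (inv_into U \<phi>)"
  unfolding continuous_map_def
proof (intro conjI allI impI)
  show "inv_into U \<phi> \<in> topspace (top_of_set (\<phi> ` U)) \<rightarrow> topspace X"
    using chart_inv(1)[OF assms] openin_subset[OF chart_domain[OF assms]] by auto
next
  fix W assume "openin X W"
  have "openin (top_of_set (\<phi> ` U)) (\<phi> ` (U \<inter> W))"
    using chart_open_image[OF assms \<open>openin X W\<close>] by (auto intro!: open_openin_trans chart_image[OF assms])
  then show "openin (top_of_set (\<phi> ` U)) {y \<in> topspace (top_of_set (\<phi> ` U)). inv_into U \<phi> y \<in> W}"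
    using chart_inv_vimage[OF assms, of W] by simp
qed

lemma chart_inv_measurable:
  assumes "(U, \<phi>) \<in> atlas"
  shows "inv_into U \<phi> \<in> restrict_space borel (\<phi> ` U) \<rightarrow>\<^sub>M borel_of X"
  unfolding borel_of_def
proof (rule measurable_measure_of)
  show "{U. openin X U} \<subseteq> Pow (topspace X)" by (auto dest: openin_subset)
  show "inv_into U \<phi> \<in> space (restrict_space borel (\<phi> ` U)) \<rightarrow> topspace X"
    using chart_inv(1)[OF assms] openin_subset[OF chart_domain[OF assms]] by (auto simp: space_restrict_space)
next
  fix W assume "W \<in> {U. openin X U}"
  then have "\<phi> ` (U \<inter> W) \<in> sets borel"
    using chart_open_image[OF assms] by auto
  moreover have "inv_into U \<phi> -` W \<inter> space (restrict_space borel (\<phi> ` U)) = \<phi> ` (U \<inter> W)"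
    using chart_inv_vimage[OF assms, of W] by (auto simp: space_restrict_space)
  ultimately show "inv_into U \<phi> -` W \<inter> space (restrict_space borel (\<phi> ` U)) \<in> sets (restrict_space borel (\<phi> ` U))"
    using chart_image[OF assms] by (auto simp: sets_restrict_space_iff)
qed

text \<open>An image under the chart is a preimage under its inverse, and the inverse is
  measurable.\<close>

lemma chart_image_borel:
  assumes "(U, \<phi>) \<in> atlas" "A \<in> sets (borel_of X)"
  shows "\<phi> ` (U \<inter> A) \<in> sets borel"
proof -
  have "inv_into U \<phi> -` A \<inter> space (restrict_space borel (\<phi> ` U)) \<in> sets (restrict_space borel (\<phi> ` U))"
    using measurable_sets[OF chart_inv_measurable[OF assms(1)] assms(2)] .
  moreover have "inv_into U \<phi> -` A \<inter> space (restrict_space borel (\<phi> ` U)) = \<phi> ` (U \<inter> A)"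
    using chart_inv_vimage[OF assms(1), of A] by (auto simp: space_restrict_space)
  ultimately show ?thesis
    using chart_image[OF assms(1)] by (auto simp: sets_restrict_space_iff)
qed

lemma transition_chart:
  assumes "(U, \<phi>) \<in> atlas" "x \<in> U"
  shows "transition (U, \<phi>) (V, \<psi>) (\<phi> x) = \<psi> x"
  using chart_inj[OF assms(1)] assms(2) by (simp add: transition_def inv_into_f_f)

lemma transition_derivative:
  assumes "(U, \<phi>) \<in> atlas" "(V, \<psi>) \<in> atlas" "y \<in> \<phi> ` (U \<inter> V)"
  shows "(transition (U, \<phi>) (V, \<psi>) has_derivative frechet_derivative (transition (U, \<phi>) (V, \<psi>)) (at y)) (at y)"
proof -
  have "Ck_on (Suc 0) (transition (U, \<phi>) (V, \<psi>)) (\<phi> ` (U \<inter> V))"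
    using transition_smooth[OF assms(1,2)] unfolding smooth_on_def by blast
  then show ?thesis
    using assms(3) by (auto simp add: frechet_derivative_works[symmetric])
qed

lemma transition_derivative_continuous:
  assumes "(U, \<phi>) \<in> atlas" "(V, \<psi>) \<in> atlas"
  shows "continuous_on (\<phi> ` (U \<inter> V)) (\<lambda>y. frechet_derivative (transition (U, \<phi>) (V, \<psi>)) (at y) v)"
proof -
  have "Ck_on (Suc 0) (transition (U, \<phi>) (V, \<psi>)) (\<phi> ` (U \<inter> V))"
    using transition_smooth[OF assms] unfolding smooth_on_def by blast
  then show ?thesis by simp
qed

lemma chart_at:
  assumes "p \<in> topspace X"
  obtains U \<phi> where "(U, \<phi>) \<in> atlas" "p \<in> U"
proof -
  have "p \<in> (\<Union>(U, \<phi>)\<in>atlas. U)" using assms by (simp only: atlas_covers)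
  then show thesis using that by auto
qed

end

context riemannian_manifold
begin

lemma metric_continuous: "(U, \<phi>) \<in> atlas \<Longrightarrow> continuous_on (\<phi> ` U) (g (U, \<phi>))"
  using metric_smooth[of U \<phi>] unfolding smooth_on_def by (auto dest: spec[of _ 0])

lemma det_metric_pos: "(U, \<phi>) \<in> atlas \<Longrightarrow> y \<in> \<phi> ` U \<Longrightarrow> 0 < det (g (U, \<phi>) y)"
  by (rule det_positive_definite) (rule metric_positive)

lemma metric_transition:
  assumes "(U, \<phi>) \<in> atlas" "(V, \<psi>) \<in> atlas" "y \<in> \<phi> ` (U \<inter> V)"
  shows "v \<bullet> (g (U, \<phi>) y *v w) =
    frechet_derivative (transition (U, \<phi>) (V, \<psi>)) (at y) v \<bullet>
      (g (V, \<psi>) (transition (U, \<phi>) (V, \<psi>) y) *v frechet_derivative (transition (U, \<phi>) (V, \<psi>)) (at y) w)"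
  using metric_transforms[OF assms, of v w] by (simp add: Let_def)

lemma sqrt_det_metric_transition:
  assumes "(U, \<phi>) \<in> atlas" "(V, \<psi>) \<in> atlas" "y \<in> \<phi> ` (U \<inter> V)"
  shows "sqrt (det (g (U, \<phi>) y)) =
    \<bar>det (matrix (frechet_derivative (transition (U, \<phi>) (V, \<psi>)) (at y)))\<bar> *
      sqrt (det (g (V, \<psi>) (transition (U, \<phi>) (V, \<psi>) y)))"
proof -
  let ?D = "frechet_derivative (transition (U, \<phi>) (V, \<psi>)) (at y)"
  have "linear ?D"
    using transition_derivative[OF assms] by (rule has_derivative_linear)
  then have D: "matrix ?D *v v = ?D v" for v by (simp add: matrix_vector_mul)
  have "det (g (U, \<phi>) y) = (det (matrix ?D))\<^sup>2 * det (g (V, \<psi>) (transition (U, \<phi>) (V, \<psi>) y))"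
    by (rule inner_matrix_congruence) (simp only: D metric_transition[OF assms])
  then show ?thesis by (simp add: real_sqrt_mult)
qed

lemma volume_density_measurable:
  assumes "(U, \<phi>) \<in> atlas" "S \<subseteq> \<phi> ` U" "S \<in> sets borel"
  shows "(\<lambda>y. indicator S y * sqrt (det (g (U, \<phi>) y))) \<in> borel_measurable borel"
proof -
  have "continuous_on S (\<lambda>y. sqrt (det (g (U, \<phi>) y)))"
    using continuous_on_subset[OF metric_continuous[OF assms(1)] assms(2)] by (intro continuous_intros)
  from borel_measurable_continuous_on_indicator[OF assms(3) this] show ?thesis
    by simp
qed

section \<open>Existence and uniqueness of the Riemannian volume\<close>

definition chart_integral :: "('a, 'd) chart \<Rightarrow> 'a set \<Rightarrow> ennreal" where
  "chart_integral c A = (\<integral>\<^sup>+ y\<in>snd c ` A. ennreal (sqrt (det (g c y))) \<partial>lborel)"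

text \<open>Change of variables along the transition map: its Jacobian is exactly the factor by
  which the densities of the two charts differ.\<close>

lemma chart_integral_compatible:
  assumes c: "c \<in> atlas" and c': "c' \<in> atlas"
    and A: "A \<in> sets (borel_of X)" "A \<subseteq> fst c" "A \<subseteq> fst c'"
  shows "chart_integral c A = chart_integral c' A"
proof -
  obtain U \<phi> V \<psi> where cc: "c = (U, \<phi>)" "c' = (V, \<psi>)" by (metis surj_pair)
  note c = c[unfolded cc] and c' = c'[unfolded cc]
  have AU: "U \<inter> A = A" "V \<inter> A = A" using A cc by auto
  have sub: "\<phi> ` A \<subseteq> \<phi> ` (U \<inter> V)" "\<psi> ` A \<subseteq> \<psi> ` V" "\<phi> ` A \<subseteq> \<phi> ` U" using A cc by auto
  let ?\<tau> = "transition (U, \<phi>) (V, \<psi>)"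
  have \<tau>: "?\<tau> (\<phi> x) = \<psi> x" if "x \<in> A" for x
    using transition_chart[OF c] that A cc by auto
  then have image: "?\<tau> ` (\<phi> ` A) = \<psi> ` A" by (simp add: image_image)
  have borel: "\<phi> ` A \<in> sets borel" "\<psi> ` A \<in> sets borel"
    using chart_image_borel[OF c A(1)] chart_image_borel[OF c' A(1)] by (simp_all add: AU)
  have dens: "sqrt (det (g (U, \<phi>) y)) = \<bar>det (matrix (frechet_derivative ?\<tau> (at y)))\<bar> * sqrt (det (g (V, \<psi>) (?\<tau> y)))"
    if "y \<in> \<phi> ` A" for y
    by (rule sqrt_det_metric_transition[OF c c' subsetD[OF sub(1) that]])
  have "(\<integral>\<^sup>+ y\<in>?\<tau> ` (\<phi> ` A). ennreal (sqrt (det (g (V, \<psi>) y))) \<partial>lborel) =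
    (\<integral>\<^sup>+ y\<in>\<phi> ` A. ennreal (\<bar>det (matrix (frechet_derivative ?\<tau> (at y)))\<bar> * sqrt (det (g (V, \<psi>) (?\<tau> y)))) \<partial>lborel)"
  proof (rule nn_integral_change_of_variables[where g = ?\<tau> and f = "\<lambda>y. sqrt (det (g (V, \<psi>) y))", OF borel(1)])
    show "(?\<tau> has_derivative frechet_derivative ?\<tau> (at y)) (at y within \<phi> ` A)" if "y \<in> \<phi> ` A" for y
      by (rule has_derivative_at_withinI[OF transition_derivative[OF c c' subsetD[OF sub(1) that]]])
    have "inj_on \<psi> A" using chart_inj[OF c'] A cc by (auto intro: inj_on_subset)
    then show "inj_on ?\<tau> (\<phi> ` A)" by (auto simp: inj_on_def \<tau>)
    show "0 \<le> sqrt (det (g (V, \<psi>) y))" if "y \<in> ?\<tau> ` (\<phi> ` A)" for y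
      using that sub(2) det_metric_pos[OF c', of y] unfolding image by (simp add: less_imp_le subsetD)
    show "(\<lambda>y. indicator (?\<tau> ` \<phi> ` A) y * sqrt (det (g (V, \<psi>) y))) \<in> borel_measurable borel"
      unfolding image by (rule volume_density_measurable[OF c' sub(2) borel(2)])
    have "(\<lambda>y. indicator (\<phi> ` A) y * (\<bar>det (matrix (frechet_derivative ?\<tau> (at y)))\<bar> * sqrt (det (g (V, \<psi>) (?\<tau> y)))))
      = (\<lambda>y. indicator (\<phi> ` A) y * sqrt (det (g (U, \<phi>) y)))"
      using dens by (simp add: fun_eq_iff indicator_def)
    then show "(\<lambda>y. indicator (\<phi> ` A) y * (\<bar>det (matrix (frechet_derivative ?\<tau> (at y)))\<bar> * sqrt (det (g (V, \<psi>) (?\<tau> y)))))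
        \<in> borel_measurable borel"
      using volume_density_measurable[OF c sub(3) borel(1)] by simp
  qed
  also have "\<dots> = (\<integral>\<^sup>+ y\<in>\<phi> ` A. ennreal (sqrt (det (g (U, \<phi>) y))) \<partial>lborel)"
    using dens by (intro nn_integral_cong) (simp add: indicator_def)
  finally show ?thesis by (simp add: image cc chart_integral_def)
qed

text \<open>The density is placed on the coordinate domain and pushed forward by the inverse chart.
  Besides supplying the local volume, this shows that \<open>chart_integral c\<close> is additive on
  Borel subsets of the chart.\<close>

lemma chart_measure_exists:
  assumes c: "c \<in> atlas"
  shows "\<exists>\<nu>. sets \<nu> = sets (borel_of X) \<and>
    (\<forall>A\<in>sets (borel_of X). A \<subseteq> fst c \<longrightarrow> emeasure \<nu> A = chart_integral c A)"
proof -
  obtain U \<phi> where cc: "c = (U, \<phi>)" by (metis surj_pair)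
  note c = c[unfolded cc]
  have open_image: "\<phi> ` U \<in> sets borel" using chart_image[OF c] by simp
  let ?R = "restrict_space lborel (\<phi> ` U)"
  let ?f = "\<lambda>y. ennreal (sqrt (det (g (U, \<phi>) y)))"
  have inv: "inv_into U \<phi> \<in> ?R \<rightarrow>\<^sub>M borel_of X"
    using chart_inv_measurable[OF c] by (subst measurable_cong_sets[OF sets_restrict_space_cong refl]) auto
  have "(\<lambda>y. sqrt (det (g (U, \<phi>) y))) \<in> borel_measurable (restrict_space borel (\<phi> ` U))"
    using metric_continuous[OF c] by (intro borel_measurable_continuous_on_restrict continuous_intros)
  then have "(\<lambda>y. sqrt (det (g (U, \<phi>) y))) \<in> borel_measurable ?R"
    by (subst measurable_cong_sets[OF sets_restrict_space_cong refl]) auto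
  then have f: "?f \<in> borel_measurable ?R"
    by (rule measurable_compose[OF _ measurable_ennreal])
  define \<nu> where "\<nu> = distr (density ?R ?f) (borel_of X) (inv_into U \<phi>)"
  have "emeasure \<nu> A = chart_integral c A" if A: "A \<in> sets (borel_of X)" "A \<subseteq> U" for A
  proof -
    have pre: "inv_into U \<phi> -` A \<inter> space ?R = \<phi> ` A"
      using chart_inv_vimage[OF c, of A] A(2) by (auto simp: space_restrict_space Int_absorb1)
    have "emeasure \<nu> A = emeasure (density ?R ?f) (\<phi> ` A)"
      unfolding \<nu>_def using inv A pre by (subst emeasure_distr) auto
    also have "\<dots> = (\<integral>\<^sup>+ y. ?f y * indicator (\<phi> ` A) y \<partial>?R)"
      using measurable_sets[OF inv A(1)] f unfolding pre by (intro emeasure_density)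
    also have "\<dots> = (\<integral>\<^sup>+ y. ?f y * indicator (\<phi> ` A) y * indicator (\<phi> ` U) y \<partial>lborel)"
      using open_image by (subst nn_integral_restrict_space) auto
    also have "\<dots> = chart_integral c A"
      unfolding chart_integral_def cc using A(2) by (intro nn_integral_cong) (auto simp: indicator_def)
    finally show ?thesis .
  qed
  then show ?thesis by (intro exI[of _ \<nu>]) (auto simp: \<nu>_def cc)
qed

definition is_volume :: "'a measure \<Rightarrow> bool" where
  "is_volume \<nu> \<longleftrightarrow> sets \<nu> = sets (borel_of X) \<and>
    (\<forall>c\<in>atlas. \<forall>A\<in>sets (borel_of X). A \<subseteq> fst c \<longrightarrow> emeasure \<nu> A = chart_integral c A)"

lemma riemannian_volume_eq: "riemannian_volume X atlas g = (THE \<nu>. is_volume \<nu>)"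
  unfolding riemannian_volume_def is_volume_def chart_integral_def
  by (simp add: case_prod_unfold)

text \<open>Disjointing a finite subcover by charts gives Borel pieces on each of which one chart
  prescribes the volume.\<close>

lemma finite_chart_partition:
  assumes "compact_space X"
  obtains I :: "nat set" and c D where "finite I" "\<And>i. i \<in> I \<Longrightarrow> c i \<in> atlas"
    "\<And>i. i \<in> I \<Longrightarrow> D i \<in> sets (borel_of X)" "\<And>i. i \<in> I \<Longrightarrow> D i \<subseteq> fst (c i)"
    "disjoint_family_on D I" "(\<Union>i\<in>I. D i) = topspace X"
proof -
  have "\<forall>U\<in>fst ` atlas. openin X U" using chart_domain by auto
  moreover have "topspace X \<subseteq> \<Union> (fst ` atlas)" unfolding atlas_covers[symmetric] by auto
  ultimately obtain F where F: "finite F" "F \<subseteq> fst ` atlas" "topspace X \<subseteq> \<Union> F"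
    using assms unfolding compact_space_alt by meson
  obtain C where C: "C \<subseteq> atlas" "finite C" "F = fst ` C"
    using finite_subset_image[OF F(1,2)] by blast
  obtain cs where cs: "set cs = C" using finite_list[OF C(2)] by blast
  \<comment> \<open>Padding with empty sets turns the finite cover into the sequence that
    \<open>disjointed\<close> expects.\<close>
  define D where "D = disjointed (\<lambda>i. if i < length cs then fst (cs ! i) else {})"
  have nth: "cs ! i \<in> atlas" if "i < length cs" for i using that C cs nth_mem by blast
  show thesis
  proof (rule that[of "{..<length cs}" "\<lambda>i. cs ! i" D])
    have "openin X (fst (cs ! i))" if "i < length cs" for i
      using nth[OF that] chart_domain by (metis prod.collapse)
    then have "range (\<lambda>i. if i < length cs then fst (cs ! i) else {}) \<subseteq> sets (borel_of X)"
      using openin_borel_of by auto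
    from sets.range_disjointed_sets[OF this] show "D i \<in> sets (borel_of X)" for i
      by (auto simp: D_def)
    show sub: "D i \<subseteq> fst (cs ! i)" if "i \<in> {..<length cs}" for i
      using that disjointed_subset[of "\<lambda>i. if i < length cs then fst (cs ! i) else {}" i] by (auto simp: D_def)
    show "disjoint_family_on D {..<length cs}"
      unfolding D_def using disjoint_family_disjointed by (rule disjoint_family_on_mono[rotated]) simp
    have "D i = {}" if "\<not> i < length cs" for i
      using that disjointed_subset[of "\<lambda>i. if i < length cs then fst (cs ! i) else {}" i] by (auto simp: D_def)
    then have "(\<Union>i\<in>{..<length cs}. D i) = (\<Union>i. D i)"
    proof (intro equalityI UN_least)
      show "D i \<subseteq> (\<Union>i\<in>{..<length cs}. D i)" if "\<And>i. \<not> i < length cs \<Longrightarrow> D i = {}" for i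
        by (cases "i < length cs") (use that in auto)
    qed auto
    also have "\<dots> = (\<Union>i. if i < length cs then fst (cs ! i) else {})"
      unfolding D_def by (rule UN_disjointed_eq)
    also have "\<dots> = (\<Union>i\<in>{..<length cs}. fst (cs ! i))"
      by (auto split: if_splits)
    also have "\<dots> = \<Union> (fst ` set cs)"
    proof -
      have "set cs = (!) cs ` {..<length cs}" by (auto simp: set_conv_nth)
      then show ?thesis by (simp add: image_image)
    qed
    also have "\<dots> = topspace X"
    proof
      show "\<Union> (fst ` set cs) \<subseteq> topspace X"
      proof (rule Union_least)
        fix W assume "W \<in> fst ` set cs"
        then obtain \<phi> where "(W, \<phi>) \<in> atlas" using C cs by auto
        then show "W \<subseteq> topspace X" by (intro openin_subset chart_domain)
      qed
      show "topspace X \<subseteq> \<Union> (fst ` set cs)" using F C cs by simp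
    qed
    finally show "(\<Union>i\<in>{..<length cs}. D i) = topspace X" .
  qed (use nth in auto)
qed

text \<open>Existence: the chart measures cut down to the pieces \<open>D i\<close> are added. A
  piece of a set inside another chart \<open>c'\<close> lies in two charts, where compatibility
  applies. Uniqueness: every Borel set splits into pieces on which the volume is prescribed.\<close>

lemma is_volume_riemannian_volume:
  assumes "compact_space X"
  shows "is_volume (riemannian_volume X atlas g)"
proof -
  obtain I :: "nat set" and c D where I: "finite I" "\<And>i. i \<in> I \<Longrightarrow> c i \<in> atlas"
    "\<And>i. i \<in> I \<Longrightarrow> D i \<in> sets (borel_of X)" "\<And>i. i \<in> I \<Longrightarrow> D i \<subseteq> fst (c i)"
    "disjoint_family_on D I" "(\<Union>i\<in>I. D i) = topspace X"
    by (rule finite_chart_partition[OF assms]) blast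
  have cover: "emeasure \<nu> A = (\<Sum>i\<in>I. emeasure \<nu> (A \<inter> D i))"
    if "sets \<nu> = sets (borel_of X)" "A \<in> sets (borel_of X)" for \<nu> A
    using that I sets.sets_into_space[OF that(2)] by (intro sum_emeasure_cover) auto
  have "\<exists>\<nu>. \<forall>i\<in>I. sets (\<nu> i) = sets (borel_of X) \<and>
    (\<forall>A\<in>sets (borel_of X). A \<subseteq> fst (c i) \<longrightarrow> emeasure (\<nu> i) A = chart_integral (c i) A)"
    using chart_measure_exists I(2) by (intro bchoice) auto
  then obtain \<nu> where \<nu>: "\<And>i. i \<in> I \<Longrightarrow> sets (\<nu> i) = sets (borel_of X)"
    "\<And>i A. i \<in> I \<Longrightarrow> A \<in> sets (borel_of X) \<Longrightarrow> A \<subseteq> fst (c i) \<Longrightarrow> emeasure (\<nu> i) A = chart_integral (c i) A"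
    by metis
  obtain \<mu> where \<mu>: "sets \<mu> = sets (borel_of X)"
    "\<And>A. A \<in> sets (borel_of X) \<Longrightarrow> emeasure \<mu> A = (\<Sum>i\<in>I. emeasure (density (\<nu> i) (indicator (D i))) A)"
    using sum_measure_exists[OF I(1), of "\<lambda>i. density (\<nu> i) (indicator (D i))" "borel_of X"] \<nu>(1) by auto
  have "is_volume \<mu>"
    unfolding is_volume_def
  proof (intro conjI ballI impI)
    fix c' A assume c': "c' \<in> atlas" and A: "A \<in> sets (borel_of X)" "A \<subseteq> fst c'"
    \<comment> \<open>Provides the additivity needed to reassemble \<open>chart_integral c'\<close>
      from the pieces \<open>A \<inter> D i\<close>.\<close>
    obtain \<nu>' where \<nu>': "sets \<nu>' = sets (borel_of X)"
      "\<And>A. A \<in> sets (borel_of X) \<Longrightarrow> A \<subseteq> fst c' \<Longrightarrow> emeasure \<nu>' A = chart_integral c' A"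
      using chart_measure_exists[OF c'] by blast
    have "emeasure (density (\<nu> i) (indicator (D i))) A = emeasure \<nu>' (A \<inter> D i)" if i: "i \<in> I" for i
    proof -
      have "emeasure (density (\<nu> i) (indicator (D i))) A = emeasure (\<nu> i) (A \<inter> D i)"
        using emeasure_restricted[of "D i" "\<nu> i" A] \<nu>(1)[OF i] I(3)[OF i] A(1) by (simp add: Int_commute)
      also have "\<dots> = chart_integral (c i) (A \<inter> D i)"
        using I(3,4)[OF i] A by (intro \<nu>(2)[OF i]) auto
      also have "\<dots> = chart_integral c' (A \<inter> D i)"
        using I(3,4)[OF i] A by (intro chart_integral_compatible I(2) i c') auto
      also have "\<dots> = emeasure \<nu>' (A \<inter> D i)"
        using I(3)[OF i] A by (intro \<nu>'(2)[symmetric]) auto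
      finally show ?thesis .
    qed
    then have "emeasure \<mu> A = (\<Sum>i\<in>I. emeasure \<nu>' (A \<inter> D i))"
      by (simp add: \<mu>(2)[OF A(1)])
    also have "\<dots> = chart_integral c' A"
      using cover[OF \<nu>'(1) A(1)] \<nu>'(2)[OF A] by simp
    finally show "emeasure \<mu> A = chart_integral c' A" .
  qed (rule \<mu>(1))
  moreover have "\<mu>' = \<mu>" if "is_volume \<mu>'" for \<mu>'
  proof (rule measure_eqI)
    show "sets \<mu>' = sets \<mu>" using that \<mu>(1) by (simp add: is_volume_def)
    fix A assume "A \<in> sets \<mu>'"
    then have A: "A \<in> sets (borel_of X)" using that by (simp add: is_volume_def)
    have "emeasure \<mu>' (A \<inter> D i) = emeasure \<mu> (A \<inter> D i)" if "i \<in> I" for i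
    proof -
      have "A \<inter> D i \<in> sets (borel_of X)" "A \<inter> D i \<subseteq> fst (c i)"
        using A I(3,4)[OF that] by auto
      then show ?thesis
        using \<open>is_volume \<mu>'\<close> \<open>is_volume \<mu>\<close> I(2)[OF that] by (simp add: is_volume_def)
    qed
    then show "emeasure \<mu>' A = emeasure \<mu> A"
      using cover[of \<mu>' A] cover[of \<mu> A] A that \<mu>(1) by (simp add: is_volume_def)
  qed
  ultimately show ?thesis
    unfolding riemannian_volume_eq by (rule theI)
qed

lemma emeasure_riemannian_volume_chart:
  assumes "compact_space X" "(U, \<phi>) \<in> atlas" "A \<in> sets (borel_of X)" "A \<subseteq> U"
  shows "emeasure (riemannian_volume X atlas g) A = (\<integral>\<^sup>+ y\<in>\<phi> ` A. ennreal (sqrt (det (g (U, \<phi>) y))) \<partial>lborel)"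
proof -
  have "\<forall>A\<in>sets (borel_of X). A \<subseteq> fst (U, \<phi>) \<longrightarrow>
      emeasure (riemannian_volume X atlas g) A = chart_integral (U, \<phi>) A"
    using is_volume_riemannian_volume[OF assms(1)] assms(2) unfolding is_volume_def by blast
  then show ?thesis using assms(3,4) by (simp add: chart_integral_def)
qed

lemma sets_riemannian_volume:
  "compact_space X \<Longrightarrow> sets (riemannian_volume X atlas g) = sets (borel_of X)"
  using is_volume_riemannian_volume by (simp add: is_volume_def)

section \<open>Coordinate balls: volume and distance\<close>

text \<open>On a compact coordinate ball the continuous metric is bounded; one constant
  \<open>C\<close> serves for the quadratic form, hence for lengths, and for the volume
  density.\<close>

lemma chart_cball:
  assumes "p \<in> topspace X"
  obtains U \<phi> r C where "(U, \<phi>) \<in> atlas" "p \<in> U" "0 < r" "cball (\<phi> p) r \<subseteq> \<phi> ` U" "0 < C"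
    "\<And>y w. y \<in> cball (\<phi> p) r \<Longrightarrow> w \<bullet> (g (U, \<phi>) y *v w) \<le> C * (norm w)\<^sup>2"
    "\<And>y. y \<in> cball (\<phi> p) r \<Longrightarrow> sqrt (det (g (U, \<phi>) y)) \<le> C"
proof -
  obtain U \<phi> where U: "(U, \<phi>) \<in> atlas" "p \<in> U" by (rule chart_at[OF assms])
  obtain r where r: "0 < r" "cball (\<phi> p) r \<subseteq> \<phi> ` U"
    using chart_image[OF U(1)] U(2) by (meson imageI open_contains_cball)
  let ?K = "cball (\<phi> p) r"
  let ?G = "g (U, \<phi>)"
  have cont: "continuous_on ?K ?G" using continuous_on_subset[OF metric_continuous[OF U(1)] r(2)] .
  \<comment> \<open>The entrywise sum is continuous and dominates the operator norm of the metric
    matrix.\<close>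
  define n where "n y = (\<Sum>i\<in>UNIV. \<Sum>j\<in>UNIV. \<bar>?G y $ i $ j\<bar>)" for y
  have "continuous_on ?K (\<lambda>y. n y + \<bar>sqrt (det (?G y))\<bar>)"
    unfolding n_def by (intro continuous_intros cont)
  moreover have "?K \<noteq> {}" using r(1) by simp
  ultimately have "\<exists>z\<in>?K. \<forall>y\<in>?K. n y + \<bar>sqrt (det (?G y))\<bar> \<le> n z + \<bar>sqrt (det (?G z))\<bar>"
    by (intro continuous_attains_sup compact_cball)
  then obtain C0 where C0: "\<And>y. y \<in> ?K \<Longrightarrow> n y + \<bar>sqrt (det (?G y))\<bar> \<le> C0" by blast
  have n0: "0 \<le> n y" for y unfolding n_def by (intro sum_nonneg) auto
  show thesis
  proof (rule that[OF U r])
    have "0 \<le> C0" using C0[of "\<phi> p"] n0[of "\<phi> p"] r(1) by auto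
    \<comment> \<open>Adding 1 makes the constant strictly positive, so that a radius can later be
      defined by dividing by its square root.\<close>
    then show "0 < C0 + 1" by simp
    fix y assume y: "y \<in> ?K"
    show "sqrt (det (?G y)) \<le> C0 + 1" using C0[OF y] n0[of y] by linarith
    fix w
    have "w \<bullet> (?G y *v w) \<le> norm w * norm (?G y *v w)" by (rule norm_cauchy_schwarz)
    also have "\<dots> \<le> norm w * (n y * norm w)"
    proof (intro mult_left_mono)
      have "norm (?G y *v w) \<le> onorm ((*v) (?G y)) * norm w"
        by (rule onorm) simp
      also have "\<dots> \<le> n y * norm w"
        unfolding n_def by (intro mult_right_mono onorm_le_matrix_component_sum) simp
      finally show "norm (?G y *v w) \<le> n y * norm w" .
    qed simp
    also have "\<dots> = n y * (norm w)\<^sup>2" by (simp add: power2_eq_square)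
    also have "\<dots> \<le> (C0 + 1) * (norm w)\<^sup>2"
      using C0[OF y] by (intro mult_right_mono) auto
    finally show "w \<bullet> (?G y *v w) \<le> (C0 + 1) * (norm w)\<^sup>2" .
  qed
qed

text \<open>Euclidean balls in coordinates take the place of metric balls: openness and volume can
  be read off in the chart, and an upper estimate of the distance is enough.\<close>

definition chart_ball :: "('a, 'd) chart \<Rightarrow> 'a \<Rightarrow> real \<Rightarrow> 'a set" where
  "chart_ball c p \<rho> = {x \<in> fst c. snd c x \<in> ball (snd c p) \<rho>}"

lemma openin_chart_ball: "(U, \<phi>) \<in> atlas \<Longrightarrow> openin X (chart_ball (U, \<phi>) p \<rho>)"
  unfolding chart_ball_def fst_conv snd_conv by (rule chart_open_preimage) auto

lemma image_chart_ball:
  assumes "ball (\<phi> p) \<rho> \<subseteq> \<phi> ` U"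
  shows "\<phi> ` chart_ball (U, \<phi>) p \<rho> = ball (\<phi> p) \<rho>"
  using assms unfolding chart_ball_def by auto

text \<open>A vanishing integral would force the positive density to vanish almost everywhere on the
  ball, making a Euclidean ball Lebesgue-null.\<close>

lemma volume_chart_ball_pos:
  assumes "compact_space X" "(U, \<phi>) \<in> atlas" "0 < \<rho>" "ball (\<phi> p) \<rho> \<subseteq> \<phi> ` U"
  shows "0 < emeasure (riemannian_volume X atlas g) (chart_ball (U, \<phi>) p \<rho>)"
proof (rule ccontr)
  let ?B = "ball (\<phi> p) \<rho>"
  assume "\<not> ?thesis"
  then have "(\<integral>\<^sup>+ y\<in>?B. ennreal (sqrt (det (g (U, \<phi>) y))) \<partial>lborel) = 0"
    using emeasure_riemannian_volume_chart[OF assms(1,2) openin_borel_of[OF openin_chart_ball[OF assms(2)]], of p \<rho>]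
    by (simp add: image_chart_ball[OF assms(4)]) (simp add: chart_ball_def)
  moreover have "(\<integral>\<^sup>+ y\<in>?B. ennreal (sqrt (det (g (U, \<phi>) y))) \<partial>lborel)
      = (\<integral>\<^sup>+ y. ennreal (indicator ?B y * sqrt (det (g (U, \<phi>) y))) \<partial>lborel)"
    by (intro nn_integral_cong) (simp add: indicator_def)
  moreover have "(\<lambda>y. ennreal (indicator ?B y * sqrt (det (g (U, \<phi>) y)))) \<in> borel_measurable lborel"
    using measurable_compose[OF volume_density_measurable[OF assms(2,4)] measurable_ennreal] by simp
  ultimately have "AE y in lborel. ennreal (indicator ?B y * sqrt (det (g (U, \<phi>) y))) = 0"
    by (simp only: nn_integral_0_iff_AE)
  then have "AE y in lborel. y \<notin> ?B"
  proof (rule eventually_mono)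
    fix y assume y: "ennreal (indicator ?B y * sqrt (det (g (U, \<phi>) y))) = 0"
    show "y \<notin> ?B"
    proof
      assume "y \<in> ?B"
      moreover from this have "0 < det (g (U, \<phi>) y)"
        using det_metric_pos[OF assms(2)] assms(4) by blast
      ultimately show False using y by (simp add: ennreal_eq_0_iff)
    qed
  qed
  then have "?B \<in> null_sets lborel"
    by (simp add: AE_iff_null_sets)
  then have "emeasure lborel ?B = 0" by auto
  then show False
    using assms(3) unit_ball_vol_pos[of "real CARD('d)"] by (simp add: emeasure_ball)
qed

lemma volume_chart_ball_finite:
  assumes "compact_space X" "(U, \<phi>) \<in> atlas" "ball (\<phi> p) \<rho> \<subseteq> \<phi> ` U"
    and "\<And>y. y \<in> ball (\<phi> p) \<rho> \<Longrightarrow> sqrt (det (g (U, \<phi>) y)) \<le> C"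
  shows "emeasure (riemannian_volume X atlas g) (chart_ball (U, \<phi>) p \<rho>) < \<infinity>"
proof -
  let ?B = "ball (\<phi> p) \<rho>"
  have "emeasure (riemannian_volume X atlas g) (chart_ball (U, \<phi>) p \<rho>) = (\<integral>\<^sup>+ y\<in>?B. ennreal (sqrt (det (g (U, \<phi>) y))) \<partial>lborel)"
    using emeasure_riemannian_volume_chart[OF assms(1,2) openin_borel_of[OF openin_chart_ball[OF assms(2)]], of p \<rho>]
    by (simp add: image_chart_ball[OF assms(3)]) (simp add: chart_ball_def)
  also have "\<dots> \<le> (\<integral>\<^sup>+ y. ennreal C * indicator ?B y \<partial>lborel)"
    using assms(4) by (intro nn_integral_mono) (auto simp: indicator_def intro: ennreal_leI)
  also have "\<dots> = ennreal C * emeasure lborel ?B"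
    by (rule nn_integral_cmult_indicator) simp
  also have "\<dots> < \<infinity>"
    using emeasure_bounded_finite[OF bounded_ball, of "\<phi> p" \<rho>] by (simp add: ennreal_mult_less_top)
  finally show ?thesis .
qed

text \<open>The density can be unbounded on a whole chart image, so the finite cover consists of
  sets of finite volume obtained from compact coordinate balls.\<close>

lemma finite_riemannian_volume:
  assumes "compact_space X"
  shows "emeasure (riemannian_volume X atlas g) (topspace X) < \<infinity>"
proof -
  let ?vol = "riemannian_volume X atlas g"
  let ?\<U> = "{W. openin X W \<and> emeasure ?vol W < \<infinity>}"
  have "topspace X \<subseteq> \<Union> ?\<U>"
  proof
    fix p assume "p \<in> topspace X"
    then obtain U \<phi> r C where *: "(U, \<phi>) \<in> atlas" "p \<in> U" "0 < r" "cball (\<phi> p) r \<subseteq> \<phi> ` U"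
      "\<And>y. y \<in> cball (\<phi> p) r \<Longrightarrow> sqrt (det (g (U, \<phi>) y)) \<le> C"
      by (rule chart_cball) blast
    then have "emeasure ?vol (chart_ball (U, \<phi>) p r) < \<infinity>"
      using ball_subset_cball[of "\<phi> p" r] by (intro volume_chart_ball_finite[OF assms, where C = C]) auto
    moreover have "p \<in> chart_ball (U, \<phi>) p r" using * by (simp add: chart_ball_def)
    ultimately show "p \<in> \<Union> ?\<U>" using openin_chart_ball[OF *(1)] by blast
  qed
  moreover have "\<forall>W\<in>?\<U>. openin X W" by simp
  ultimately obtain F where F: "finite F" "F \<subseteq> ?\<U>" "topspace X \<subseteq> \<Union> F"
    using assms unfolding compact_space_alt by meson
  have "F \<subseteq> sets ?vol" using F(2) openin_borel_of sets_riemannian_volume[OF assms] by auto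
  then have "emeasure ?vol (topspace X) \<le> emeasure ?vol (\<Union>W\<in>F. W)"
    using F(1,3) by (intro emeasure_mono) auto
  also have "\<dots> \<le> (\<Sum>W\<in>F. emeasure ?vol W)"
    using F(1) \<open>F \<subseteq> sets ?vol\<close> by (intro emeasure_subadditive_finite) auto
  also have "\<dots> < \<infinity>" using F(1,2) by auto
  finally show ?thesis .
qed

text \<open>The straight coordinate segment from \<open>p\<close> to \<open>x\<close> has speed at
  most \<open>sqrt C\<close> times its Euclidean length. The work lies in the other charts: the
  curve must be regular in each of them, and \<open>speed\<close> evaluates in an unspecified
  one.\<close>

lemma riemannian_dist_chart_ball_le:
  assumes c: "(U, \<phi>) \<in> atlas" and p: "p \<in> U" and x: "x \<in> chart_ball (U, \<phi>) p \<rho>"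
    and sub: "ball (\<phi> p) \<rho> \<subseteq> \<phi> ` U" and C: "0 \<le> C"
    and bound: "\<And>y w. y \<in> ball (\<phi> p) \<rho> \<Longrightarrow> w \<bullet> (g (U, \<phi>) y *v w) \<le> C * (norm w)\<^sup>2"
  shows "riemannian_dist X atlas g p x \<le> ennreal (sqrt C * \<rho>)"
proof -
  define w where "w = \<phi> x - \<phi> p"
  define l where "l t = \<phi> p + t *\<^sub>R w" for t :: real
  define \<gamma> where "\<gamma> = inv_into U \<phi> \<circ> l"
  have w: "norm w < \<rho>" using x by (simp add: chart_ball_def w_def dist_norm norm_minus_commute)
  then have \<rho>: "0 < \<rho>" using norm_ge_zero[of w] by linarith
  have l_ball: "l t \<in> ball (\<phi> p) \<rho>" if "t \<in> {0..1}" for t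
  proof -
    have "norm (t *\<^sub>R w) \<le> norm w" using that mult_right_mono[of t 1 "norm w"] by simp
    then show ?thesis using w by (simp add: l_def dist_norm)
  qed
  then have l_chart: "l t \<in> \<phi> ` U" if "t \<in> {0..1}" for t using that sub by blast
  have l_deriv: "(l has_vector_derivative w) (at t)" for t
    unfolding l_def by (auto intro!: derivative_eq_intros)
  have l_cont: "continuous_on S l" for S
    unfolding l_def by (intro continuous_intros)
  have in_both: "l t \<in> \<phi> ` (U \<inter> V)" if "t \<in> {0..1}" "\<gamma> t \<in> V" for t V
    using chart_inv_vimage[OF c, of V] l_chart[OF that(1)] that(2) by (auto simp: \<gamma>_def)
  \<comment> \<open>The identity holds at all real parameters, so the derivatives at the endpoints 0
    and 1 are two-sided, as \<open>speed\<close> and the regularity condition ask.\<close>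
  have coord: "\<psi> \<circ> \<gamma> = transition (U, \<phi>) (V, \<psi>) \<circ> l" for V \<psi>
    by (simp add: transition_def \<gamma>_def comp_assoc)
  have coord_deriv: "(\<psi> \<circ> \<gamma> has_vector_derivative
      frechet_derivative (transition (U, \<phi>) (V, \<psi>)) (at (l t)) w) (at t)"
    if "t \<in> {0..1}" "\<gamma> t \<in> V" "(V, \<psi>) \<in> atlas" for t V \<psi>
    unfolding coord[of \<psi> V]
    by (rule vector_derivative_diff_chain_within[OF l_deriv])
      (rule has_derivative_at_withinI[OF transition_derivative[OF c that(3) in_both[OF that(1,2)]]])
  have "pathin X \<gamma>"
    unfolding pathin_def \<gamma>_def
  proof (rule continuous_map_compose[OF _ chart_inv_continuous[OF c]])
    show "continuous_map (top_of_set {0..1}) (top_of_set (\<phi> ` U)) l"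
      using l_cont l_chart by (auto simp: continuous_map_in_subtopology)
  qed
  have "piecewise_C1_curve X atlas \<gamma>"
    unfolding piecewise_C1_curve_def
  proof (intro conjI ballI, fact, clarify)
    fix V \<psi> a b assume V: "(V, \<psi>) \<in> atlas" and ab: "0 \<le> a" "a < b" "b \<le> (1::real)" "\<gamma> ` {a..b} \<subseteq> V"
    have t: "t \<in> {0..1}" "\<gamma> t \<in> V" if "t \<in> {a..b}" for t using ab that by auto
    have "l ` {a..b} \<subseteq> \<phi> ` (U \<inter> V)"
      by (rule image_subsetI) (rule in_both[OF t])
    then have "continuous_on {a..b} (\<lambda>t. frechet_derivative (transition (U, \<phi>) (V, \<psi>)) (at (l t)) w)"
      by (rule continuous_on_compose2[OF transition_derivative_continuous[OF c V] l_cont])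
    then have "(\<psi> \<circ> \<gamma>) C1_differentiable_on {a..b}"
      unfolding C1_differentiable_on_def
      by (intro exI conjI ballI) (rule coord_deriv[OF t V], assumption+)
    then show "(\<psi> \<circ> \<gamma>) piecewise_C1_differentiable_on {a..b}"
      by (rule C1_differentiable_imp_piecewise)
  qed
  moreover have "\<gamma> 0 = p" "\<gamma> 1 = x"
    using p x chart_inj[OF c] by (auto simp: \<gamma>_def l_def w_def chart_ball_def inv_into_f_f)
  ultimately have "riemannian_dist X atlas g p x \<le> curve_length atlas g \<gamma>"
    unfolding riemannian_dist_def by (intro INF_lower) simp
  also have "\<dots> \<le> (\<integral>\<^sup>+ t. ennreal (sqrt C * \<rho>) * indicator {0..1} t \<partial>(lborel :: real measure))"
    unfolding curve_length_def
  proof (intro nn_integral_mono)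
    fix t :: real
    have "speed atlas g \<gamma> t \<le> sqrt C * \<rho>" if t: "t \<in> {0..1}"
    proof -
      \<comment> \<open>The chart selected by \<open>speed\<close> is arbitrary; the transformation
        law of the metric brings the value back to the chart \<open>U\<close>, where the bound
        applies.\<close>
      define c' where "c' = (SOME c. c \<in> atlas \<and> \<gamma> t \<in> fst c)"
      have "\<gamma> t \<in> U" using chart_inv(1)[OF c l_chart[OF t]] by (simp add: \<gamma>_def)
      with c have "c' \<in> atlas \<and> \<gamma> t \<in> fst c'"
        unfolding c'_def by (metis (mono_tags, lifting) fst_conv someI)
      then obtain V \<psi> where V: "c' = (V, \<psi>)" "(V, \<psi>) \<in> atlas" "\<gamma> t \<in> V" by (metis prod.collapse)
      let ?D = "frechet_derivative (transition (U, \<phi>) (V, \<psi>)) (at (l t))"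
      have "speed atlas g \<gamma> t = sqrt (?D w \<bullet> (g (V, \<psi>) (\<psi> (\<gamma> t)) *v ?D w))"
        using vector_derivative_at[OF coord_deriv[OF t V(3,2)]]
        unfolding speed_def c'_def[symmetric] V(1) by (simp add: Let_def)
      also have "\<psi> (\<gamma> t) = transition (U, \<phi>) (V, \<psi>) (l t)"
        using fun_cong[OF coord[of \<psi> V], of t] by simp
      also have "?D w \<bullet> (g (V, \<psi>) (transition (U, \<phi>) (V, \<psi>) (l t)) *v ?D w) = w \<bullet> (g (U, \<phi>) (l t) *v w)"
        by (rule metric_transition[OF c V(2) in_both[OF t V(3)], symmetric])
      also have "sqrt \<dots> \<le> sqrt (C * (norm w)\<^sup>2)"
        by (intro real_sqrt_le_mono bound l_ball t)
      also have "\<dots> \<le> sqrt C * \<rho>"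
        using w C by (simp add: real_sqrt_mult mult_left_mono)
      finally show ?thesis .
    qed
    then show "ennreal (speed atlas g \<gamma> t) * indicator {0..1} t \<le> ennreal (sqrt C * \<rho>) * indicator {0..1} t"
      by (auto simp: indicator_def intro: ennreal_leI)
  qed
  also have "\<dots> = ennreal (sqrt C * \<rho>)"
    by (subst nn_integral_cmult_indicator) auto
  finally show ?thesis .
qed

lemma normalized_volume:
  assumes "compact_space X" "topspace X \<noteq> {}"
  shows "normalized_volume X atlas g \<in> finite_measures (borel_of X)"
    and "measure (normalized_volume X atlas g) (topspace X) = 1"
    and "0 < emeasure (riemannian_volume X atlas g) A \<Longrightarrow> A \<in> sets (borel_of X) \<Longrightarrow>
      0 < measure (normalized_volume X atlas g) A"
proof -
  let ?vol = "riemannian_volume X atlas g" and ?\<tau> = "normalized_volume X atlas g"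
  note sets = sets_riemannian_volume[OF assms(1)]
  have space: "space ?vol = topspace X" using sets_eq_imp_space_eq[OF sets] by simp
  define v where "v = emeasure ?vol (topspace X)"
  have "0 < v"
  proof -
    obtain p where "p \<in> topspace X" using assms(2) by blast
    then obtain U \<phi> r where *: "(U, \<phi>) \<in> atlas" "0 < r" "cball (\<phi> p) r \<subseteq> \<phi> ` U"
      by (rule chart_cball) blast
    then have "ball (\<phi> p) r \<subseteq> \<phi> ` U" using ball_subset_cball[of "\<phi> p" r] by blast
    from volume_chart_ball_pos[OF assms(1) *(1,2) this]
    show ?thesis
      unfolding v_def using openin_subset[OF openin_chart_ball[OF *(1)]] sets.top[of ?vol] space
      by (metis emeasure_mono order_less_le_trans)
  qed
  moreover have "v < \<infinity>" unfolding v_def by (rule finite_riemannian_volume[OF assms(1)])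
  \<comment> \<open>In \<open>ennreal\<close> the inverse of 0 is infinite and that of infinity is
    0, so both bounds on the total volume are needed for the normalization.\<close>
  ultimately have v: "v \<noteq> 0" "v \<noteq> top" "inverse v \<noteq> 0" "inverse v \<noteq> top"
    by (auto simp: ennreal_inverse_eq_0_iff)
  have em: "emeasure ?\<tau> A = inverse v * emeasure ?vol A" for A
    by (simp add: normalized_volume_def Let_def v_def)
  have space': "space ?\<tau> = topspace X"
    by (simp add: normalized_volume_def Let_def space_scale_measure space)
  have one: "emeasure ?\<tau> (topspace X) = 1"
    using v by (simp add: em v_def[symmetric] ennreal_inverse_mult less_top mult.commute ennreal_mult_divide_eq divide_ennreal_def[symmetric])
  then interpret prob_space ?\<tau> by (intro prob_spaceI) (simp add: space')
  show "?\<tau> \<in> finite_measures (borel_of X)"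
    by (simp add: finite_measures_def finite_measure_axioms) (simp add: normalized_volume_def Let_def sets)
  show "measure ?\<tau> (topspace X) = 1" using one by (simp add: measure_def)
  assume "0 < emeasure ?vol A"
  then have "0 < emeasure ?\<tau> A" using v by (simp add: em ennreal_zero_less_mult_iff zero_less_iff_neq_zero)
  then show "0 < measure ?\<tau> A" by (simp add: emeasure_eq_measure)
qed

end

section \<open>The strategy on a compact manifold\<close>

theorem theorem4p6:
  fixes X :: "'a topology"
    and atlas :: "('a, 'd::finite) chart set"
    and g :: "('a, 'd) chart \<Rightarrow> real ^ 'd \<Rightarrow> real ^ 'd ^ 'd"
    and N0 :: nat
  assumes "riemannian_manifold X atlas g"
    and "compact_space X"
    and "CARD('d) \<ge> 3"
    and "N0 > 0"
  shows "\<exists>K::nat. K > 0 \<and>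
    (\<forall>x. (\<forall>i\<ge>1. x i \<in> topspace X) \<longrightarrow>
      (\<exists>y. (\<forall>j\<ge>1. y j \<in> topspace X) \<and>
        (\<forall>N. 1 \<le> N \<and> N \<le> N0 \<longrightarrow>
          W1_signed (borel_of X) (riemannian_dist X atlas g)
            (\<lambda>A. 1 / (2 * real N + real K) * shop_measure (borel_of X) x y K N A)
            (measure (normalized_volume X atlas g))
          > W1_signed (borel_of X) (riemannian_dist X atlas g)
            (\<lambda>A. 1 / (2 * real N + real K) * (- shop_measure (borel_of X) x y K N A))
            (measure (normalized_volume X atlas g)))))"
proof (cases "topspace X = {}")
  case True
  \<comment> \<open>An empty space admits no sequence \<open>x\<close>, so any \<open>K\<close>
    works; no volume could be normalized here.\<close>
  then show ?thesis by (intro exI[of _ 1]) auto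
next
  case False
  then obtain p where p: "p \<in> topspace X" by blast
  interpret riemannian_manifold X atlas g by fact
  note \<tau> = normalized_volume[OF assms(2) False]
  obtain U \<phi> r C where c: "(U, \<phi>) \<in> atlas" "p \<in> U" "0 < r" "cball (\<phi> p) r \<subseteq> \<phi> ` U" "0 < C"
    "\<And>y w. y \<in> cball (\<phi> p) r \<Longrightarrow> w \<bullet> (g (U, \<phi>) y *v w) \<le> C * (norm w)\<^sup>2"
    by (rule chart_cball[OF p]) blast
  \<comment> \<open>Small enough to stay in the chart ball where the metric is controlled, and to
    make the distance bound \<open>sqrt C * \<rho>\<close> at most 1.\<close>
  define \<rho> where "\<rho> = min r (1 / sqrt C)"
  have \<rho>: "0 < \<rho>" "\<rho> \<le> r" "sqrt C * \<rho> \<le> 1"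
    using c(3,5) by (auto simp: \<rho>_def min_def field_simps)
  have ball: "ball (\<phi> p) \<rho> \<subseteq> cball (\<phi> p) r" using \<rho> by auto
  let ?B = "chart_ball (U, \<phi>) p \<rho>"
  have B: "?B \<in> sets (borel_of X)" by (rule openin_borel_of[OF openin_chart_ball[OF c(1)]])
  have B_pos: "0 < measure (normalized_volume X atlas g) ?B"
    using ball c(4) by (intro \<tau>(3) B volume_chart_ball_pos[OF assms(2) c(1) \<rho>(1)]) auto
  have dist: "riemannian_dist X atlas g p y \<le> 1" if "y \<in> ?B" for y
  proof -
    have "riemannian_dist X atlas g p y \<le> ennreal (sqrt C * \<rho>)"
    proof (rule riemannian_dist_chart_ball_le[OF c(1,2) that])
      show "ball (\<phi> p) \<rho> \<subseteq> \<phi> ` U" using ball c(4) by blast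
    qed (use ball c(5,6) in auto)
    also have "\<dots> \<le> 1" using \<rho>(3) by simp
    finally show ?thesis .
  qed
  have mass: "measure (normalized_volume X atlas g) (space (borel_of X)) = 1" using \<tau>(2) by simp
  from rival_wins_from_point[where d = "riemannian_dist X atlas g" and p = p and ?N0.0 = N0, OF \<tau>(1) mass singleton_borel_of[OF Hausdorff p] B B_pos dist]
  obtain K where K: "K > 0" "\<And>x N. (\<forall>i\<ge>1. x i \<in> topspace X) \<Longrightarrow> 1 \<le> N \<Longrightarrow> N \<le> N0 \<Longrightarrow>
      W1_signed (borel_of X) (riemannian_dist X atlas g)
        (\<lambda>A. 1 / (2 * real N + real K) * shop_measure (borel_of X) x (\<lambda>_. p) K N A) (measure (normalized_volume X atlas g))
      > W1_signed (borel_of X) (riemannian_dist X atlas g)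
        (\<lambda>A. 1 / (2 * real N + real K) * (- shop_measure (borel_of X) x (\<lambda>_. p) K N A)) (measure (normalized_volume X atlas g))"
    by auto
  show ?thesis
    using K p by (intro exI[of _ K] conjI allI impI exI[of _ "\<lambda>_. p"]) auto
qed

end
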